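(* Let $d\ge2$, let $l/k$ be a finite Galois extension of fields, let $G$ be a finite subgroup of $GL_d(l)\rtimes\operatorname{Gal}(l/k)$ with $|G|$ not divisible by $\operatorname{char} k$ and $k=l^G$, and let $S:=l[[x_1,\ldots,x_d]]$. Let $H:=G\cap GL_d(l)$, a normal subgroup of $G$. If $H\subseteq GL_d(l)$ is small, then the canonical ring homomorphism \[S*G\to\operatorname{End}_{S^G}(S),\qquad s*g\mapsto\bigl(s'\mapsto s\,g(s')\bigr)\] is an isomorphism; thus $\operatorname{End}_{S^G}(S)\cong S*G$.
   Context: In $GL_d(l)\rtimes\operatorname{Gal}(l/k)$ the Galois group acts on matrices entrywise, so $(A,\sigma)(B,\tau)=(A\sigma(B),\sigma\tau)$. This group acts on $S$ by continuous $k$-algebra automorphisms determined by $(A,\sigma)(\lambda)=\sigma(\lambda)$ for $\lambda\in l$ and $(A,\sigma)(x_j)=a_{1j}x_1+\cdots+a_{dj}x_d$ for $A=[a_{ij}]$; $G$ acts on $l$ through the projection to $\operatorname{Gal}(l/k)$. $GL_d(l)$ is identified with $GL_d(l)\times\{\mathrm{id}\}$. $A\in GL_d(l)$ is a pseudo-reflection if $\operatorname{rank}(A-I_d)\le1$; a finite subgroup of $GL_d(l)$ is small if it contains no pseudo-reflection other than $I_d$. $S*G$ is the skew group ring: the free left $S$-module with basis $G$ and multiplication $(s*g)(s'*g')=s\,g(s')*gg'$. *)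

theory Defs
  imports "HOL-Analysis.Cartesian_Space" "HOL-Library.Poly_Mapping"
    "HOL-Algebra.Algebraic_Closure_Type"
begin

unbundle no fps_syntax

section \<open>Power series in finitely many variables\<close>

text \<open>
  An element of \<open>('a, 'n) mfps\<close> is a formal power series over \<open>'a\<close> in variables indexed by the
  finite type \<open>'n\<close>; a monomial is given by its exponent vector in \<open>nat ^ 'n\<close>.
\<close>

typedef ('a, 'n::finite) mfps = "UNIV :: (nat ^ 'n \<Rightarrow> 'a) set"
  morphisms mfps_nth Abs_mfps ..

setup_lifting type_definition_mfps

lemma mfps_eqI: "(\<And>m. mfps_nth f m = mfps_nth g m) \<Longrightarrow> f = g"
  by (metis ext mfps_nth_inject)

definition exponent_splits :: "nat ^ 'n \<Rightarrow> ((nat ^ 'n) \<times> (nat ^ 'n)) set"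
  where "exponent_splits m = {(a, b). a + b = m}"

lemma finite_exponents_le: "finite {a :: nat ^ 'n. \<forall>i. a $ i \<le> m $ i}"
proof (rule finite_subset)
  show "{a :: nat ^ 'n. \<forall>i. a $ i \<le> m $ i} \<subseteq> vec_lambda ` (PiE UNIV (\<lambda>i. {..m $ i}))"
  proof
    fix a :: "nat ^ 'n" assume "a \<in> {a. \<forall>i. a $ i \<le> m $ i}"
    then have "a = vec_lambda (vec_nth a)" "vec_nth a \<in> PiE UNIV (\<lambda>i. {..m $ i})"
      by (auto simp: vec_eq_iff)
    then show "a \<in> vec_lambda ` (PiE UNIV (\<lambda>i. {..m $ i}))" by blast
  qed
qed (auto intro!: finite_imageI finite_PiE)

lemma finite_exponent_splits [simp]: "finite (exponent_splits m)"
proof (rule finite_subset)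
  let ?E = "{a. \<forall>i. a $ i \<le> m $ i}"
  show "exponent_splits m \<subseteq> ?E \<times> ?E" by (auto simp: exponent_splits_def)
  show "finite (?E \<times> ?E)" using finite_exponents_le by blast
qed

instantiation mfps :: (comm_ring_1, finite) comm_ring_1
begin

lift_definition zero_mfps :: "('a, 'b) mfps" is "\<lambda>_. 0" .
lift_definition one_mfps :: "('a, 'b) mfps" is "\<lambda>m. if m = 0 then 1 else 0" .
lift_definition plus_mfps :: "('a, 'b) mfps \<Rightarrow> ('a, 'b) mfps \<Rightarrow> ('a, 'b) mfps"
  is "\<lambda>f g m. f m + g m" .
lift_definition minus_mfps :: "('a, 'b) mfps \<Rightarrow> ('a, 'b) mfps \<Rightarrow> ('a, 'b) mfps"
  is "\<lambda>f g m. f m - g m" .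
lift_definition uminus_mfps :: "('a, 'b) mfps \<Rightarrow> ('a, 'b) mfps" is "\<lambda>f m. - f m" .
lift_definition times_mfps :: "('a, 'b) mfps \<Rightarrow> ('a, 'b) mfps \<Rightarrow> ('a, 'b) mfps"
  is "\<lambda>f g m. \<Sum>(a, b)\<in>exponent_splits m. f a * g b" .

instance
proof
  fix f g h :: "('a, 'b) mfps"
  show "f * g * h = f * (g * h)"
  proof (rule mfps_eqI)
    fix m
    let ?F = "mfps_nth f" and ?G = "mfps_nth g" and ?H = "mfps_nth h"
    have "mfps_nth (f * g * h) m
        = (\<Sum>x\<in>exponent_splits m. \<Sum>y\<in>exponent_splits (fst x). ?F (fst y) * ?G (snd y) * ?H (snd x))"
      by (simp add: times_mfps.rep_eq case_prod_beta sum_distrib_right)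
    also have "\<dots> = (\<Sum>(x, y)\<in>(SIGMA x:exponent_splits m. exponent_splits (fst x)).
        ?F (fst y) * ?G (snd y) * ?H (snd x))"
      by (rule sum.Sigma) auto
    also have "\<dots> = (\<Sum>(x, y)\<in>(SIGMA x:exponent_splits m. exponent_splits (snd x)).
        ?F (fst x) * (?G (fst y) * ?H (snd y)))"
      by (rule sum.reindex_bij_witness[of _
            "\<lambda>(x, y). ((fst x + fst y, snd y), (fst x, fst y))"
            "\<lambda>(x, y). ((fst y, snd y + snd x), (snd y, snd x))"])
        (auto simp: exponent_splits_def add.assoc mult.assoc)
    also have "\<dots> = (\<Sum>x\<in>exponent_splits m. \<Sum>y\<in>exponent_splits (snd x). ?F (fst x) * (?G (fst y) * ?H (snd y)))"
      by (rule sum.Sigma[symmetric]) auto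
    also have "\<dots> = mfps_nth (f * (g * h)) m"
      by (simp add: times_mfps.rep_eq case_prod_beta sum_distrib_left)
    finally show "mfps_nth (f * g * h) m = mfps_nth (f * (g * h)) m" .
  qed
  show "f * g = g * f"
  proof (rule mfps_eqI)
    fix m
    show "mfps_nth (f * g) m = mfps_nth (g * f) m"
      unfolding times_mfps.rep_eq
      by (rule sum.reindex_bij_witness[of _ prod.swap prod.swap])
        (auto simp: exponent_splits_def add.commute mult.commute)
  qed
  show "1 * f = f"
  proof (rule mfps_eqI)
    fix m
    have "mfps_nth (1 * f) m = (\<Sum>x\<in>exponent_splits m. if x = (0, m) then mfps_nth f m else 0)"
      unfolding times_mfps.rep_eq
      by (intro sum.cong) (auto simp: exponent_splits_def one_mfps.rep_eq split: if_splits)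
    also have "\<dots> = mfps_nth f m"
      by (subst sum.delta) (simp_all, auto simp: exponent_splits_def)
    finally show "mfps_nth (1 * f) m = mfps_nth f m" .
  qed
  show "(f + g) * h = f * h + g * h"
    by (rule mfps_eqI)
      (simp add: times_mfps.rep_eq plus_mfps.rep_eq case_prod_beta distrib_right sum.distrib)
  show "(0 :: ('a, 'b) mfps) \<noteq> 1"
  proof
    assume "(0 :: ('a, 'b) mfps) = 1"
    then have "mfps_nth (0 :: ('a, 'b) mfps) 0 = mfps_nth 1 0" by simp
    then show False by (simp add: zero_mfps.rep_eq one_mfps.rep_eq)
  qed
qed (rule mfps_eqI; simp add: plus_mfps.rep_eq zero_mfps.rep_eq minus_mfps.rep_eq
      uminus_mfps.rep_eq algebra_simps)+

end

lift_definition mfps_const :: "'a::comm_ring_1 \<Rightarrow> ('a, 'n::finite) mfps"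
  is "\<lambda>c m. if m = 0 then c else 0" .

lift_definition mfps_var :: "'n \<Rightarrow> ('a::comm_ring_1, 'n::finite) mfps"
  is "\<lambda>i m. if m = axis i 1 then 1 else 0" .

definition total_degree :: "nat ^ 'n \<Rightarrow> nat"
  where "total_degree m = (\<Sum>i\<in>UNIV. m $ i)"

text \<open>
  Continuity for the topology with neighbourhood basis of \<open>0\<close> given by the powers of the ideal
  generated by the variables, i.e. by the sets of series without terms of degree below \<open>N\<close>. It is
  only used for additive maps, for which continuity at \<open>0\<close> is continuity.
\<close>

definition mfps_vanish_below :: "nat \<Rightarrow> ('a::comm_ring_1, 'n::finite) mfps set"
  where "mfps_vanish_below N = {f. \<forall>m. total_degree m < N \<longrightarrow> mfps_nth f m = 0}"

definition mfps_continuous ::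
  "(('a::comm_ring_1, 'n::finite) mfps \<Rightarrow> ('a, 'n) mfps) \<Rightarrow> bool"
  where "mfps_continuous \<phi> \<longleftrightarrow> (\<forall>N. \<exists>M. \<forall>f h. f - h \<in> mfps_vanish_below M \<longrightarrow> \<phi> f - \<phi> h \<in> mfps_vanish_below N)"


section \<open>Galois extensions and the semidirect product\<close>

abbreviation field_ring :: "'l::field ring"
  where "field_ring \<equiv> ring_of_type_algebra"

text \<open>
  In the next definitions the extension is that of the whole type \<open>'l\<close> over the subfield \<open>K\<close>.
\<close>

definition polys_over :: "'l::field set \<Rightarrow> 'l poly set"
  where "polys_over K = {p. \<forall>i. Polynomial.coeff p i \<in> K}"

definition irreducible_over :: "'l::field set \<Rightarrow> 'l poly \<Rightarrow> bool"
  where "irreducible_over K p \<longleftrightarrow> p \<in> polys_over K \<and> Polynomial.degree p > 0 \<and>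
    (\<forall>q\<in>polys_over K. \<forall>r\<in>polys_over K. p = q * r \<longrightarrow>
       Polynomial.degree q = 0 \<or> Polynomial.degree r = 0)"

definition normal_extension :: "'l::field set \<Rightarrow> bool"
  where "normal_extension K \<longleftrightarrow> (\<forall>p. irreducible_over K p \<and> (\<exists>a. poly p a = 0) \<longrightarrow>
    (\<exists>c as. p = Polynomial.smult c (\<Prod>a\<leftarrow>as. [:- a, 1:])))"

definition separable_extension :: "'l::field set \<Rightarrow> bool"
  where "separable_extension K \<longleftrightarrow>
    (\<forall>a. \<exists>p. irreducible_over K p \<and> poly p a = 0 \<and> coprime p (pderiv p))"

definition finite_galois :: "'l::field set \<Rightarrow> bool"
  where "finite_galois K \<longleftrightarrow> subfield K field_ring \<and>
    ring.finite_dimension (field_ring :: 'l ring) K UNIV \<and>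
    normal_extension K \<and> separable_extension K"

definition Gal :: "'l::field set \<Rightarrow> ('l \<Rightarrow> 'l) set"
  where "Gal K = {\<sigma> \<in> ring_iso field_ring field_ring. \<forall>a\<in>K. \<sigma> a = a}"

type_synonym ('l, 'd) semilinear = "('l ^ 'd ^ 'd) \<times> ('l \<Rightarrow> 'l)"

definition GL_Gal :: "'l::field set \<Rightarrow> ('l, 'd::finite) semilinear monoid"
  where "GL_Gal K = \<lparr>carrier = {A. invertible A} \<times> Gal K,
     monoid.mult = (\<lambda>(A, \<sigma>) (B, \<tau>). (A ** map_matrix \<sigma> B, \<sigma> \<circ> \<tau>)),
     one = (mat 1, id)\<rparr>"

definition linear_part :: "('l::field, 'd::finite) semilinear set \<Rightarrow> ('l ^ 'd ^ 'd) set"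
  where "linear_part G = {A. (A, id) \<in> G}"

definition pseudo_reflection :: "'l::field ^ 'd ^ 'd \<Rightarrow> bool"
  where "pseudo_reflection A \<longleftrightarrow> invertible A \<and> rank (A - mat 1) \<le> 1"

definition small :: "('l::field ^ 'd ^ 'd) set \<Rightarrow> bool"
  where "small H \<longleftrightarrow> (\<forall>A\<in>H. pseudo_reflection A \<longrightarrow> A = mat 1)"

definition fixed_field :: "('l::field, 'd::finite) semilinear set \<Rightarrow> 'l set"
  where "fixed_field G = {a. \<forall>(A, \<sigma>)\<in>G. \<sigma> a = a}"


section \<open>The action on power series\<close>

text \<open>The image of the \<open>j\<close>-th variable under the matrix \<open>A\<close>.\<close>

definition linear_form :: "'l::field ^ 'd ^ 'd \<Rightarrow> 'd \<Rightarrow> ('l, 'd::finite) mfps"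
  where "linear_form A j = (\<Sum>i\<in>UNIV. mfps_const (A $ i $ j) * mfps_var i)"

definition form_monom :: "'l::field ^ 'd ^ 'd \<Rightarrow> nat ^ 'd \<Rightarrow> ('l, 'd::finite) mfps"
  where "form_monom A a = (\<Prod>j\<in>UNIV. linear_form A j ^ (a $ j))"

text \<open>
  Explicitly, \<open>(A, \<sigma>)\<close> sends a series with coefficients \<open>f\<^sub>a\<close> to the sum of all
  \<open>\<sigma> f\<^sub>a * form_monom A a\<close>. As \<open>form_monom A a\<close> is homogeneous of degree \<open>total_degree a\<close>, the
  coefficient at \<open>b\<close> only involves the finitely many \<open>a\<close> of the same degree as \<open>b\<close>.
  Theorem \<open>mfps_act_unique\<close> below shows that this is the unique continuous ring automorphism
  with the prescribed values on constants and variables.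
\<close>

definition mfps_act ::
  "('l::field, 'd::finite) semilinear \<Rightarrow> ('l, 'd) mfps \<Rightarrow> ('l, 'd) mfps"
  where "mfps_act = (\<lambda>(A, \<sigma>) f. Abs_mfps (\<lambda>b.
    \<Sum>a | total_degree a = total_degree b. \<sigma> (mfps_nth f a) * mfps_nth (form_monom A a) b))"

definition invariants :: "('l::field, 'd::finite) semilinear set \<Rightarrow> ('l, 'd) mfps set"
  where "invariants G = {f. \<forall>g\<in>G. mfps_act g f = f}"


section \<open>Skew group rings and endomorphism rings\<close>

text \<open>
  The free module on the elements of the group consists of the finitely supported functions;
  \<open>Poly_Mapping.single g s\<close> is the element written \<open>s * g\<close> in the usual notation. The product is
  the biadditive extension of \<open>(s * g) (t * h) = (s \<cdot> g(t)) * gh\<close>.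
\<close>

definition skew_group_ring ::
  "('g, 'm) monoid_scheme \<Rightarrow> ('g \<Rightarrow> 's::comm_ring_1 \<Rightarrow> 's) \<Rightarrow> ('g \<Rightarrow>\<^sub>0 's) ring"
  where "skew_group_ring \<Gamma> act = \<lparr>carrier = {u. Poly_Mapping.keys u \<subseteq> carrier \<Gamma>},
     monoid.mult = (\<lambda>u v. \<Sum>g\<in>Poly_Mapping.keys u. \<Sum>h\<in>Poly_Mapping.keys v.
        Poly_Mapping.single (g \<otimes>\<^bsub>\<Gamma>\<^esub> h)
          (Poly_Mapping.lookup u g * act g (Poly_Mapping.lookup v h))),
     one = Poly_Mapping.single \<one>\<^bsub>\<Gamma>\<^esub> 1,
     ring.zero = 0,
     add = (+)\<rparr>"

text \<open>The ring of \<open>R\<close>-linear endomorphisms of the ambient commutative ring, for a subring \<open>R\<close>.\<close>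

definition End_ring :: "'s::comm_ring_1 set \<Rightarrow> ('s \<Rightarrow> 's) ring"
  where "End_ring R = \<lparr>carrier = {\<phi>. (\<forall>s t. \<phi> (s + t) = \<phi> s + \<phi> t) \<and>
                                   (\<forall>r\<in>R. \<forall>s. \<phi> (r * s) = r * \<phi> s)},
     monoid.mult = (\<circ>),
     one = id,
     ring.zero = (\<lambda>_. 0),
     add = (\<lambda>\<phi> \<psi> s. \<phi> s + \<psi> s)\<rparr>"

text \<open>The additive extension of \<open>s * g \<mapsto> (t \<mapsto> s \<cdot> g(t))\<close>.\<close>

definition skew_to_End ::
  "('g \<Rightarrow> 's::comm_ring_1 \<Rightarrow> 's) \<Rightarrow> ('g \<Rightarrow>\<^sub>0 's) \<Rightarrow> 's \<Rightarrow> 's"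
  where "skew_to_End act u =
    (\<lambda>t. \<Sum>g\<in>Poly_Mapping.keys u. Poly_Mapping.lookup u g * act g t)"


section \<open>Basic facts\<close>

lemma mfps_nth_ring [simp]:
  "mfps_nth 0 m = 0" "mfps_nth (f + g) m = mfps_nth f m + mfps_nth g m"
  "mfps_nth (f - g) m = mfps_nth f m - mfps_nth g m" "mfps_nth (- f) m = - mfps_nth f m"
  by (simp_all add: zero_mfps.rep_eq plus_mfps.rep_eq minus_mfps.rep_eq uminus_mfps.rep_eq)

lemma mfps_nth_one: "mfps_nth 1 m = (if m = 0 then 1 else 0)"
  by (simp add: one_mfps.rep_eq)

lemma mfps_nth_mult: "mfps_nth (f * g) m = (\<Sum>x\<in>exponent_splits m. mfps_nth f (fst x) * mfps_nth g (snd x))"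
  by (simp add: times_mfps.rep_eq case_prod_beta)

lemma mfps_nth_sum: "mfps_nth (sum f A) m = (\<Sum>x\<in>A. mfps_nth (f x) m)"
  by (induction A rule: infinite_finite_induct) auto

lemma total_degree_add [simp]: "total_degree (a + b) = total_degree a + total_degree b"
  by (simp add: total_degree_def sum.distrib)

lemma total_degree_0 [simp]: "total_degree 0 = 0"
  by (simp add: total_degree_def)

lemma total_degree_eq_0 [simp]: "total_degree a = 0 \<longleftrightarrow> a = 0"
  by (auto simp: total_degree_def vec_eq_iff)

lemma total_degree_axis [simp]: "total_degree (axis i k) = k"
  by (simp add: total_degree_def axis_def)

lemma finite_total_degree_le: "finite {a :: nat ^ 'n. total_degree a \<le> N}"
proof (rule finite_subset)
  show "{a :: nat ^ 'n. total_degree a \<le> N} \<subseteq> {a. \<forall>i. a $ i \<le> (\<chi> i. N) $ i}"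
  proof clarify
    fix a :: "nat ^ 'n" and i assume "total_degree a \<le> N"
    moreover have "a $ i \<le> total_degree a"
      unfolding total_degree_def by (rule member_le_sum) auto
    ultimately show "a $ i \<le> (\<chi> i. N) $ i" by simp
  qed
qed (rule finite_exponents_le)

lemma finite_total_degree [simp]:
  "finite {a :: nat ^ 'n. total_degree a = N}" "finite {a :: nat ^ 'n. total_degree a < N}"
  by (rule finite_subset[OF _ finite_total_degree_le[of N]]; auto)+

lift_definition mfps_monom :: "nat ^ 'n \<Rightarrow> ('a::comm_ring_1, 'n::finite) mfps"
  is "\<lambda>a m. if m = a then 1 else 0" .

lemma mfps_monom_mult: "mfps_monom a * mfps_monom b = mfps_monom (a + b)"
proof (rule mfps_eqI)
  fix m
  have "mfps_nth (mfps_monom a * mfps_monom b) m = (\<Sum>x\<in>exponent_splits m. if x = (a, b) then 1 else 0)"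
    unfolding mfps_nth_mult by (intro sum.cong) (auto simp: mfps_monom.rep_eq prod_eq_iff)
  also have "\<dots> = mfps_nth (mfps_monom (a + b)) m"
    by (subst sum.delta) (simp_all add: mfps_monom.rep_eq, auto simp: exponent_splits_def)
  finally show "mfps_nth (mfps_monom a * mfps_monom b) m = mfps_nth (mfps_monom (a + b)) m" .
qed

lemma mfps_monom_0: "mfps_monom 0 = 1"
  by (rule mfps_eqI) (simp add: mfps_monom.rep_eq mfps_nth_one)

lemma mfps_var_eq_monom: "mfps_var i = mfps_monom (axis i 1)"
  by (rule mfps_eqI) (simp add: mfps_monom.rep_eq mfps_var.rep_eq)

lemma mfps_var_power: "mfps_var i ^ k = mfps_monom (axis i k)"
proof (induction k)
  case 0
  have "axis i (0::nat) = 0" by (simp add: vec_eq_iff axis_def)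
  then show ?case by (metis mfps_monom_0 power_0)
next
  case (Suc k)
  have "axis i (1::nat) + axis i k = axis i (Suc k)" by (simp add: vec_eq_iff axis_def)
  then show ?case
    by (metis Suc mfps_monom_mult mfps_var_eq_monom power_Suc)
qed

lemma mfps_monom_eq_prod: "mfps_monom a = (\<Prod>i\<in>UNIV. mfps_var i ^ (a $ i))"
proof -
  have "(\<Prod>i\<in>S. mfps_var i ^ (a $ i)) = mfps_monom (\<Sum>i\<in>S. axis i (a $ i))" if "finite S" for S
    using that by induction (auto simp: mfps_monom_0 mfps_var_power mfps_monom_mult)
  moreover have "(\<Sum>i\<in>UNIV. axis i (a $ i)) = a"
    by (simp add: vec_eq_iff axis_def)
  ultimately show ?thesis by (metis finite)
qed

lemma mfps_nth_const_mult: "mfps_nth (mfps_const c * f) m = c * mfps_nth f m"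
proof -
  have "mfps_nth (mfps_const c * f) m = (\<Sum>x\<in>exponent_splits m. if x = (0, m) then c * mfps_nth f m else 0)"
    unfolding mfps_nth_mult
    by (intro sum.cong) (auto simp: exponent_splits_def mfps_const.rep_eq split: if_splits)
  also have "\<dots> = c * mfps_nth f m" by (subst sum.delta) (simp_all, auto simp: exponent_splits_def)
  finally show ?thesis .
qed

lemma mfps_const_simps:
  "mfps_const 0 = 0" "mfps_const 1 = 1" "mfps_const (a + b) = mfps_const a + mfps_const b"
  "mfps_const (a * b) = mfps_const a * mfps_const b"
  by (rule mfps_eqI; simp add: mfps_const.rep_eq mfps_nth_one mfps_nth_const_mult)+

lemma mfps_const_sum: "mfps_const (sum f A) = (\<Sum>x\<in>A. mfps_const (f x))"
  by (induction A rule: infinite_finite_induct) (auto simp: mfps_const_simps)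

definition homogeneous :: "nat \<Rightarrow> ('a::comm_ring_1, 'n::finite) mfps \<Rightarrow> bool"
  where "homogeneous N f \<longleftrightarrow> (\<forall>m. mfps_nth f m \<noteq> 0 \<longrightarrow> total_degree m = N)"

lemma homogeneous_one: "homogeneous 0 1"
  by (simp add: homogeneous_def mfps_nth_one)

lemma homogeneous_mult:
  assumes "homogeneous p f" "homogeneous q g"
  shows "homogeneous (p + q) (f * g)"
  unfolding homogeneous_def
proof (intro allI impI)
  fix m assume "mfps_nth (f * g) m \<noteq> 0"
  then obtain x where "x \<in> exponent_splits m" "mfps_nth f (fst x) * mfps_nth g (snd x) \<noteq> 0"
    unfolding mfps_nth_mult by (meson sum.neutral)
  moreover from this have "mfps_nth f (fst x) \<noteq> 0" "mfps_nth g (snd x) \<noteq> 0" by auto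
  ultimately show "total_degree m = p + q"
    using assms by (auto simp: homogeneous_def exponent_splits_def)
qed

lemma homogeneous_power: "homogeneous p f \<Longrightarrow> homogeneous (p * k) (f ^ k)"
  by (induction k) (auto simp: homogeneous_one intro: homogeneous_mult)

lemma homogeneous_prod:
  "(\<And>i. i \<in> A \<Longrightarrow> homogeneous (p i) (f i)) \<Longrightarrow> homogeneous (sum p A) (prod f A)"
  by (induction A rule: infinite_finite_induct) (auto simp: homogeneous_one intro: homogeneous_mult)

lemma homogeneous_linear_form:
  fixes A :: "'a::field ^ 'b::finite ^ 'b"
  shows "homogeneous 1 (linear_form A j)"
  unfolding homogeneous_def
proof (intro allI impI)
  fix m assume "mfps_nth (linear_form A j) m \<noteq> 0"
  then obtain i where "A $ i $ j * mfps_nth (mfps_var i :: ('a, 'b) mfps) m \<noteq> 0"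
    unfolding linear_form_def mfps_nth_sum mfps_nth_const_mult by (meson sum.neutral)
  then have "m = axis i 1" by (auto simp: mfps_var.rep_eq split: if_splits)
  then show "total_degree m = 1" by simp
qed

lemma homogeneous_form_monom: "homogeneous (total_degree a) (form_monom A a)"
  unfolding form_monom_def total_degree_def
  using homogeneous_power[OF homogeneous_linear_form[of A]] by (intro homogeneous_prod) simp

lemma form_monom_nth_nonzeroD: "mfps_nth (form_monom A a) b \<noteq> 0 \<Longrightarrow> total_degree a = total_degree b"
  using homogeneous_form_monom[of a A] by (auto simp: homogeneous_def)

lemma form_monom_0: "form_monom A 0 = 1"
  by (simp add: form_monom_def)

lemma form_monom_add: "form_monom A (a + b) = form_monom A a * form_monom A b"
  by (simp add: form_monom_def power_add prod.distrib)

lemma form_monom_axis: "form_monom A (axis j 1) = linear_form A j"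
proof -
  have "form_monom A (axis j 1) = (\<Prod>i\<in>UNIV. if i = j then linear_form A i else 1)"
    unfolding form_monom_def by (intro prod.cong) (auto simp: axis_def)
  then show ?thesis by simp
qed

lemma mfps_act_nth: "mfps_nth (mfps_act (A, \<sigma>) f) b =
    (\<Sum>a | total_degree a = total_degree b. \<sigma> (mfps_nth f a) * mfps_nth (form_monom A a) b)"
  by (simp add: mfps_act_def Abs_mfps_inverse)

lemma field_ring_iso_iff:
  "\<sigma> \<in> ring_iso (ring_of_type_algebra :: 'a::ring_1 ring) ring_of_type_algebra \<longleftrightarrow>
    bij \<sigma> \<and> \<sigma> 1 = 1 \<and> (\<forall>x y. \<sigma> (x + y) = \<sigma> x + \<sigma> y) \<and> (\<forall>x y. \<sigma> (x * y) = \<sigma> x * \<sigma> y)"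
  by (auto simp: ring_iso_def ring_hom_def ring_of_type_algebra_def)

context
  fixes A :: "'l::field ^ 'd::finite ^ 'd" and \<sigma> :: "'l \<Rightarrow> 'l"
  assumes \<sigma>: "\<sigma> \<in> ring_iso field_ring field_ring"
begin

lemma field_aut_simps: "\<sigma> 1 = 1" "\<sigma> (x + y) = \<sigma> x + \<sigma> y" "\<sigma> (x * y) = \<sigma> x * \<sigma> y"
  using \<sigma> by (auto simp: field_ring_iso_iff)

lemma field_aut_0: "\<sigma> 0 = 0"
  by (metis field_aut_simps(2) add_0 add_cancel_right_right)

lemma field_aut_sum: "\<sigma> (sum f S) = (\<Sum>x\<in>S. \<sigma> (f x))"
  by (induction S rule: infinite_finite_induct) (auto simp: field_aut_0 field_aut_simps)

lemma field_aut_diff: "\<sigma> (x - y) = \<sigma> x - \<sigma> y"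
  by (metis field_aut_simps(2) add_diff_cancel_right' diff_add_cancel)

lemma mfps_act_add: "mfps_act (A, \<sigma>) (f + g) = mfps_act (A, \<sigma>) f + mfps_act (A, \<sigma>) g"
  by (rule mfps_eqI) (simp add: mfps_act_nth field_aut_simps distrib_right sum.distrib)

lemma mfps_act_diff: "mfps_act (A, \<sigma>) (f - g) = mfps_act (A, \<sigma>) f - mfps_act (A, \<sigma>) g"
  by (metis mfps_act_add add_diff_cancel_right' diff_add_cancel)

lemma mfps_act_mult: "mfps_act (A, \<sigma>) (f * g) = mfps_act (A, \<sigma>) f * mfps_act (A, \<sigma>) g"
proof (rule mfps_eqI)
  fix b :: "nat ^ 'd"
  define F where "F a = \<sigma> (mfps_nth f a)" for a
  define H where "H a = \<sigma> (mfps_nth g a)" for a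
  let ?M = "\<lambda>a. mfps_nth (form_monom A a)"
  define T where "T N = {a :: nat ^ 'd. total_degree a = N}" for N
  define P where "P = {x :: (nat ^ 'd) \<times> (nat ^ 'd). total_degree (fst x) + total_degree (snd x) = total_degree b}"
  have finP: "finite P"
    by (rule finite_subset[of _ "{a. total_degree a \<le> total_degree b} \<times> {a. total_degree a \<le> total_degree b}"])
      (auto simp: P_def finite_total_degree_le)
  have "mfps_nth (mfps_act (A, \<sigma>) (f * g)) b =
      (\<Sum>c\<in>T (total_degree b). \<Sum>x\<in>exponent_splits c. F (fst x) * H (snd x) * ?M c b)"
    by (simp add: mfps_act_nth mfps_nth_mult field_aut_sum field_aut_simps sum_distrib_right F_def H_def T_def)
  also have "\<dots> = (\<Sum>(c, x)\<in>(SIGMA c:T (total_degree b). exponent_splits c). F (fst x) * H (snd x) * ?M c b)"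
    by (rule sum.Sigma) (auto simp: T_def)
  also have "\<dots> = (\<Sum>x\<in>P. F (fst x) * H (snd x) * ?M (fst x + snd x) b)"
    by (rule sum.reindex_bij_witness[of _ "\<lambda>x. (fst x + snd x, x)" snd])
      (auto simp: T_def P_def exponent_splits_def)
  also have "\<dots> = (\<Sum>x\<in>P. \<Sum>y\<in>exponent_splits b.
      (F (fst x) * ?M (fst x) (fst y)) * (H (snd x) * ?M (snd x) (snd y)))"
    by (simp add: form_monom_add mfps_nth_mult sum_distrib_left mult_ac)
  also have "\<dots> = (\<Sum>y\<in>exponent_splits b. \<Sum>x\<in>P.
      (F (fst x) * ?M (fst x) (fst y)) * (H (snd x) * ?M (snd x) (snd y)))"
    by (rule sum.swap)
  also have "\<dots> = (\<Sum>y\<in>exponent_splits b. \<Sum>x\<in>T (total_degree (fst y)) \<times> T (total_degree (snd y)).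
      (F (fst x) * ?M (fst x) (fst y)) * (H (snd x) * ?M (snd x) (snd y)))"
  proof (rule sum.cong[OF refl], rule sum.mono_neutral_right)
    fix y assume y: "y \<in> exponent_splits b"
    show "T (total_degree (fst y)) \<times> T (total_degree (snd y)) \<subseteq> P"
      using y by (auto simp: T_def P_def exponent_splits_def)
    show "\<forall>x\<in>P - T (total_degree (fst y)) \<times> T (total_degree (snd y)).
      F (fst x) * ?M (fst x) (fst y) * (H (snd x) * ?M (snd x) (snd y)) = 0"
      by (auto simp: T_def dest!: form_monom_nth_nonzeroD)
  qed (rule finP)
  also have "\<dots> = (\<Sum>y\<in>exponent_splits b. (\<Sum>a\<in>T (total_degree (fst y)). F a * ?M a (fst y)) *
      (\<Sum>a\<in>T (total_degree (snd y)). H a * ?M a (snd y)))"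
    by (simp add: sum_product sum.cartesian_product case_prod_beta)
  also have "\<dots> = mfps_nth (mfps_act (A, \<sigma>) f * mfps_act (A, \<sigma>) g) b"
    by (simp add: mfps_nth_mult mfps_act_nth F_def H_def T_def)
  finally show "mfps_nth (mfps_act (A, \<sigma>) (f * g)) b =
    mfps_nth (mfps_act (A, \<sigma>) f * mfps_act (A, \<sigma>) g) b" .
qed

lemma mfps_act_const: "mfps_act (A, \<sigma>) (mfps_const c) = mfps_const (\<sigma> c)"
proof (rule mfps_eqI)
  fix b
  have "mfps_nth (mfps_act (A, \<sigma>) (mfps_const c)) b =
    (\<Sum>a | total_degree (a :: nat ^ 'd) = total_degree b. if a = 0 then \<sigma> c * mfps_nth 1 b else 0)"
    unfolding mfps_act_nth
    by (intro sum.cong) (auto simp: mfps_const.rep_eq field_aut_0 form_monom_0)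
  also have "\<dots> = mfps_nth (mfps_const (\<sigma> c)) b"
    by (subst sum.delta) (auto simp: mfps_const.rep_eq mfps_nth_one)
  finally show "mfps_nth (mfps_act (A, \<sigma>) (mfps_const c)) b = mfps_nth (mfps_const (\<sigma> c)) b" .
qed

lemma mfps_act_var: "mfps_act (A, \<sigma>) (mfps_var j) = linear_form A j"
proof (rule mfps_eqI)
  fix b
  have "mfps_nth (mfps_act (A, \<sigma>) (mfps_var j)) b =
    (\<Sum>a | total_degree a = total_degree b. if a = axis j 1 then mfps_nth (linear_form A j) b else 0)"
    unfolding mfps_act_nth
    by (intro sum.cong) (auto simp: mfps_var.rep_eq field_aut_0 field_aut_simps form_monom_axis[simplified])
  also have "\<dots> = mfps_nth (linear_form A j) b"
    using homogeneous_linear_form[of A j] by (subst sum.delta) (auto simp: homogeneous_def)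
  finally show "mfps_nth (mfps_act (A, \<sigma>) (mfps_var j)) b = mfps_nth (linear_form A j) b" .
qed

lemma mfps_act_continuous: "mfps_continuous (mfps_act (A, \<sigma>))"
proof -
  have "mfps_act (A, \<sigma>) f \<in> mfps_vanish_below N" if "f \<in> mfps_vanish_below N" for f N
    using that by (auto simp: mfps_vanish_below_def mfps_act_nth field_aut_0)
  then show ?thesis by (auto simp: mfps_continuous_def mfps_act_diff[symmetric])
qed

end

lemma mfps_hom_ext:
  fixes \<phi> \<psi> :: "('l::field, 'd::finite) mfps \<Rightarrow> ('l, 'd) mfps"
  assumes cont: "mfps_continuous \<phi>" "mfps_continuous \<psi>"
    and hom: "\<phi> \<in> ring_hom ring_of_type_algebra ring_of_type_algebra"
      "\<psi> \<in> ring_hom ring_of_type_algebra ring_of_type_algebra"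
    and const: "\<And>c. \<phi> (mfps_const c) = \<psi> (mfps_const c)"
    and var: "\<And>j. \<phi> (mfps_var j) = \<psi> (mfps_var j)"
  shows "\<phi> = \<psi>"
proof
  fix f :: "('l, 'd) mfps"
  have h: "\<theta> 1 = 1" "\<theta> (x + y) = \<theta> x + \<theta> y" "\<theta> (x * y) = \<theta> x * \<theta> y"
    if "\<theta> \<in> {\<phi>, \<psi>}" for \<theta> x y
    using hom that by (auto simp: ring_hom_def ring_of_type_algebra_def)
  have h0: "\<theta> 0 = 0" if "\<theta> \<in> {\<phi>, \<psi>}" for \<theta> by (metis h(2)[OF that] add_0 add_cancel_right_right)
  have hsum: "\<theta> (sum u S) = (\<Sum>x\<in>S. \<theta> (u x))" if "\<theta> \<in> {\<phi>, \<psi>}" for \<theta> S and u :: "nat ^ 'd \<Rightarrow> _"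
    by (induction S rule: infinite_finite_induct) (auto simp: h0[OF that] h[OF that])
  have hprod: "\<theta> (prod u S) = (\<Prod>x\<in>S. \<theta> (u x))" if "\<theta> \<in> {\<phi>, \<psi>}" for \<theta> S and u :: "'d \<Rightarrow> _"
    by (induction S rule: infinite_finite_induct) (auto simp: h[OF that])
  have hpow: "\<theta> (x ^ k) = \<theta> x ^ k" if "\<theta> \<in> {\<phi>, \<psi>}" for \<theta> x k
    by (induction k) (auto simp: h[OF that])
  define tr where "tr M = (\<Sum>a | total_degree a < M. mfps_const (mfps_nth f a) * mfps_monom a)"
    for M
  have tr: "\<phi> (tr M) = \<psi> (tr M)" for M
    by (simp add: tr_def hsum h(3) const mfps_monom_eq_prod hprod hpow var)
  have small_tr: "f - tr M \<in> mfps_vanish_below N" if "M \<ge> N" for M N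
  proof -
    have "mfps_nth (tr M) m = mfps_nth f m" if "total_degree m < M" for m
    proof -
      have "mfps_nth (tr M) m = (\<Sum>a | total_degree a < M. if a = m then mfps_nth f m else 0)"
        unfolding tr_def mfps_nth_sum
        by (intro sum.cong) (auto simp: mfps_nth_const_mult mfps_monom.rep_eq)
      then show ?thesis using that by simp
    qed
    then show ?thesis using that by (auto simp: mfps_vanish_below_def)
  qed
  have "\<phi> f - \<psi> f \<in> mfps_vanish_below N" for N
  proof -
    obtain M1 where 1: "\<And>f h. f - h \<in> mfps_vanish_below M1 \<Longrightarrow> \<phi> f - \<phi> h \<in> mfps_vanish_below N"
      using cont(1) unfolding mfps_continuous_def by blast
    obtain M2 where 2: "\<And>f h. f - h \<in> mfps_vanish_below M2 \<Longrightarrow> \<psi> f - \<psi> h \<in> mfps_vanish_below N"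
      using cont(2) unfolding mfps_continuous_def by blast
    let ?M = "max M1 M2"
    have "\<phi> f - \<phi> (tr ?M) \<in> mfps_vanish_below N" "\<psi> f - \<psi> (tr ?M) \<in> mfps_vanish_below N"
      using small_tr by (auto intro: 1 2)
    then show ?thesis by (auto simp: mfps_vanish_below_def tr)
  qed
  then have "mfps_nth (\<phi> f) m = mfps_nth (\<psi> f) m" for m
    by (metis (mono_tags, lifting) eq_iff_diff_eq_0 lessI mem_Collect_eq mfps_nth_ring(3) mfps_vanish_below_def)
  then show "\<phi> f = \<psi> f" by (rule mfps_eqI)
qed

lemma mfps_act_hom:
  "\<sigma> \<in> ring_iso field_ring field_ring \<Longrightarrow>
    mfps_act (A, \<sigma>) \<in> ring_hom ring_of_type_algebra ring_of_type_algebra"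
  using mfps_act_const[of \<sigma> A 1]
  by (auto simp: ring_hom_def ring_of_type_algebra_def mfps_act_add mfps_act_mult mfps_const_simps
      field_aut_simps)

lemma mfps_continuous_comp:
  "mfps_continuous \<phi> \<Longrightarrow> mfps_continuous \<psi> \<Longrightarrow> mfps_continuous (\<phi> \<circ> \<psi>)"
  unfolding mfps_continuous_def comp_def by meson

lemma mfps_act_comp:
  fixes A B :: "'l::field ^ 'd::finite ^ 'd"
  assumes \<sigma>: "\<sigma> \<in> ring_iso field_ring field_ring" and \<tau>: "\<tau> \<in> ring_iso field_ring field_ring"
  shows "mfps_act (A, \<sigma>) \<circ> mfps_act (B, \<tau>) = mfps_act (A ** map_matrix \<sigma> B, \<sigma> \<circ> \<tau>)"
proof -
  have \<sigma>\<tau>: "\<sigma> \<circ> \<tau> \<in> ring_iso field_ring field_ring"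
    using \<sigma> \<tau> by (auto simp: field_ring_iso_iff bij_comp)
  have hsum: "mfps_act (A, \<sigma>) (sum u S) = (\<Sum>x\<in>S. mfps_act (A, \<sigma>) (u x))" for S and u :: "'d \<Rightarrow> _"
    using mfps_act_const[OF \<sigma>, of A 0]
    by (induction S rule: infinite_finite_induct)
      (auto simp: mfps_act_add[OF \<sigma>] mfps_const_simps field_aut_0[OF \<sigma>])
  show ?thesis
  proof (rule mfps_hom_ext)
    show "mfps_act (A, \<sigma>) \<circ> mfps_act (B, \<tau>) \<in> ring_hom ring_of_type_algebra ring_of_type_algebra"
      using mfps_act_hom[OF \<sigma>] mfps_act_hom[OF \<tau>] by (rule ring_hom_trans[rotated])
    fix j
    have "(mfps_act (A, \<sigma>) \<circ> mfps_act (B, \<tau>)) (mfps_var j) =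
        (\<Sum>i\<in>UNIV. \<Sum>m\<in>UNIV. mfps_const (\<sigma> (B $ i $ j)) * (mfps_const (A $ m $ i) * mfps_var m))"
      by (simp add: mfps_act_var[OF \<tau>] linear_form_def hsum mfps_act_mult[OF \<sigma>]
          mfps_act_const[OF \<sigma>] mfps_act_var[OF \<sigma>] sum_distrib_left)
    also have "\<dots> = (\<Sum>m\<in>UNIV. \<Sum>i\<in>UNIV. mfps_const (\<sigma> (B $ i $ j)) * (mfps_const (A $ m $ i) * mfps_var m))"
      by (rule sum.swap)
    also have "\<dots> = linear_form (A ** map_matrix \<sigma> B) j"
      by (simp add: linear_form_def matrix_matrix_mult_def mfps_const_sum mfps_const_simps
          sum_distrib_left mult_ac)
    finally show "(mfps_act (A, \<sigma>) \<circ> mfps_act (B, \<tau>)) (mfps_var j) =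
        mfps_act (A ** map_matrix \<sigma> B, \<sigma> \<circ> \<tau>) (mfps_var j)"
      by (simp add: mfps_act_var[OF \<sigma>\<tau>])
  qed (use \<sigma> \<tau> \<sigma>\<tau> in \<open>auto intro: mfps_continuous_comp mfps_act_continuous mfps_act_hom
         simp: mfps_act_const\<close>)
qed

lemma mfps_act_one: "mfps_act (mat 1, id) = id"
proof (rule mfps_hom_ext)
  have i: "id \<in> ring_iso field_ring field_ring" by (simp add: field_ring_iso_iff)
  show "mfps_continuous (mfps_act (mat 1, id))" by (rule mfps_act_continuous[OF i])
  show "mfps_continuous id" by (auto simp: mfps_continuous_def)
  show "mfps_act (mat 1, id) \<in> ring_hom ring_of_type_algebra ring_of_type_algebra"
    by (rule mfps_act_hom[OF i])
  show "id \<in> ring_hom ring_of_type_algebra ring_of_type_algebra" by (simp add: ring_hom_def)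
  show "mfps_act (mat 1, id) (mfps_const c) = id (mfps_const c)" for c
    by (simp add: mfps_act_const[OF i])
  show "mfps_act (mat 1, id) (mfps_var j) = id (mfps_var j)" for j
  proof -
    have "linear_form (mat 1) j = (\<Sum>i\<in>UNIV. if i = j then mfps_var i else 0)"
      unfolding linear_form_def by (intro sum.cong) (auto simp: mat_def mfps_const_simps)
    then show ?thesis by (simp add: mfps_act_var[OF i])
  qed
qed

lemma map_matrix_mult:
  fixes \<sigma> :: "'l::field \<Rightarrow> 'l"
  assumes "\<sigma> \<in> ring_iso field_ring field_ring"
  shows "map_matrix \<sigma> (A ** B) = map_matrix \<sigma> A ** map_matrix \<sigma> B"
  by (simp add: vec_eq_iff matrix_matrix_mult_def field_aut_sum[OF assms] field_aut_simps[OF assms])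

lemma map_matrix_one:
  fixes \<sigma> :: "'l::field \<Rightarrow> 'l"
  assumes "\<sigma> \<in> ring_iso field_ring field_ring"
  shows "map_matrix \<sigma> (mat 1) = mat 1"
  by (simp add: vec_eq_iff mat_def field_aut_0[OF assms] field_aut_simps[OF assms])

lemma map_matrix_comp: "map_matrix (\<sigma> \<circ> \<tau>) A = map_matrix \<sigma> (map_matrix \<tau> A)"
  by (simp add: vec_eq_iff)

lemma map_matrix_id: "map_matrix id A = A"
  by (simp add: vec_eq_iff)

lemma invertible_map_matrix:
  fixes \<sigma> :: "'l::field \<Rightarrow> 'l"
  assumes "\<sigma> \<in> ring_iso field_ring field_ring" "invertible A"
  shows "invertible (map_matrix \<sigma> A)"
  using assms unfolding invertible_def by (metis map_matrix_mult map_matrix_one)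

lemma Gal_iso: "\<sigma> \<in> Gal K \<Longrightarrow> \<sigma> \<in> ring_iso field_ring field_ring"
  by (simp add: Gal_def)

lemma Gal_comp: "\<sigma> \<in> Gal K \<Longrightarrow> \<tau> \<in> Gal K \<Longrightarrow> \<sigma> \<circ> \<tau> \<in> Gal K"
  by (auto simp: Gal_def field_ring_iso_iff bij_comp)

lemma Gal_inv: "\<sigma> \<in> Gal K \<Longrightarrow> inv_into UNIV \<sigma> \<in> Gal K"
  unfolding Gal_def field_ring_iso_iff
  by (smt (verit, ccfv_SIG) bij_betw_inv_into bij_inv_eq_iff mem_Collect_eq)

lemma group_GL_Gal: "group (GL_Gal K :: ('l::field, 'd::finite) semilinear monoid)"
proof (rule groupI)
  fix x :: "('l, 'd) semilinear" assume x: "x \<in> carrier (GL_Gal K)"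
  obtain A \<sigma> where xA: "x = (A, \<sigma>)" by (cases x)
  then have \<sigma>: "\<sigma> \<in> Gal K" and A: "invertible A" using x by (auto simp: GL_Gal_def)
  define \<rho> where "\<rho> = inv_into UNIV \<sigma>"
  have \<rho>: "\<rho> \<in> Gal K" using Gal_inv[OF \<sigma>] by (simp add: \<rho>_def)
  have \<rho>\<sigma>: "\<rho> \<circ> \<sigma> = id" using \<sigma> by (auto simp: Gal_def field_ring_iso_iff \<rho>_def bij_is_inj)
  obtain B where B: "B ** A = mat 1" "A ** B = mat 1" using A by (auto simp: invertible_def)
  then have "invertible B" by (auto simp: invertible_def)
  then have "(map_matrix \<rho> B, \<rho>) \<in> carrier (GL_Gal K)"
    using \<rho> by (auto simp: GL_Gal_def intro: invertible_map_matrix Gal_iso)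
  moreover have "(map_matrix \<rho> B, \<rho>) \<otimes>\<^bsub>GL_Gal K\<^esub> x = \<one>\<^bsub>GL_Gal K\<^esub>"
    by (simp add: GL_Gal_def xA \<rho>\<sigma> map_matrix_mult[OF Gal_iso[OF \<rho>], symmetric] B
        map_matrix_one[OF Gal_iso[OF \<rho>]])
  ultimately show "\<exists>y\<in>carrier (GL_Gal K). y \<otimes>\<^bsub>GL_Gal K\<^esub> x = \<one>\<^bsub>GL_Gal K\<^esub>" by blast
next
  fix x y z :: "('l, 'd) semilinear"
  assume "x \<in> carrier (GL_Gal K)" "y \<in> carrier (GL_Gal K)" "z \<in> carrier (GL_Gal K)"
  then show "x \<otimes>\<^bsub>GL_Gal K\<^esub> y \<otimes>\<^bsub>GL_Gal K\<^esub> z = x \<otimes>\<^bsub>GL_Gal K\<^esub> (y \<otimes>\<^bsub>GL_Gal K\<^esub> z)"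
    by (auto simp: GL_Gal_def map_matrix_mult[OF Gal_iso] matrix_mul_assoc comp_assoc map_matrix_comp)
next
  show "\<one>\<^bsub>GL_Gal K\<^esub> \<in> carrier (GL_Gal K :: ('l, 'd) semilinear monoid)"
    by (auto simp: GL_Gal_def Gal_def field_ring_iso_iff invertible_def intro!: exI[of _ "mat 1"])
next
  fix x :: "('l, 'd) semilinear" assume "x \<in> carrier (GL_Gal K)"
  show "\<one>\<^bsub>GL_Gal K\<^esub> \<otimes>\<^bsub>GL_Gal K\<^esub> x = x"
    by (cases x) (auto simp: GL_Gal_def map_matrix_id)
next
  fix x y :: "('l, 'd) semilinear" assume "x \<in> carrier (GL_Gal K)" "y \<in> carrier (GL_Gal K)"
  then show "x \<otimes>\<^bsub>GL_Gal K\<^esub> y \<in> carrier (GL_Gal K)"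
    by (auto simp: GL_Gal_def Gal_comp Gal_iso intro!: invertible_mult invertible_map_matrix)
qed

lemma mfps_act_GL_Gal_mult:
  "g \<in> carrier (GL_Gal K) \<Longrightarrow> h \<in> carrier (GL_Gal K) \<Longrightarrow>
    mfps_act (g \<otimes>\<^bsub>GL_Gal K\<^esub> h) = mfps_act g \<circ> mfps_act h"
  by (auto simp: GL_Gal_def mfps_act_comp Gal_iso)

lemma mfps_act_GL_Gal_one: "mfps_act \<one>\<^bsub>GL_Gal K\<^esub> = id"
  by (simp add: GL_Gal_def mfps_act_one)

theorem mfps_act_unique:
  fixes A :: "'l::field ^ 'd::finite ^ 'd"
  assumes "(A, \<sigma>) \<in> carrier (GL_Gal K)"
  shows "\<phi> \<in> ring_iso ring_of_type_algebra ring_of_type_algebra \<and> mfps_continuous \<phi> \<and>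
      (\<forall>c. \<phi> (mfps_const c) = mfps_const (\<sigma> c)) \<and>
      (\<forall>j. \<phi> (mfps_var j) = (\<Sum>i\<in>UNIV. mfps_const (A $ i $ j) * mfps_var i))
    \<longleftrightarrow> \<phi> = mfps_act (A, \<sigma>)" (is "?P \<phi> \<longleftrightarrow> _")
proof -
  interpret \<Gamma>: group "GL_Gal K :: ('l, 'd) semilinear monoid" by (rule group_GL_Gal)
  have \<sigma>: "\<sigma> \<in> ring_iso field_ring field_ring"
    using assms by (auto simp: GL_Gal_def Gal_iso)
  have "bij (mfps_act (A, \<sigma>))"
    using mfps_act_GL_Gal_mult[of "(A, \<sigma>)" K "inv\<^bsub>GL_Gal K\<^esub> (A, \<sigma>)"]
      mfps_act_GL_Gal_mult[of "inv\<^bsub>GL_Gal K\<^esub> (A, \<sigma>)" K "(A, \<sigma>)"] assms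
    by (intro o_bij[of "mfps_act (inv\<^bsub>GL_Gal K\<^esub> (A, \<sigma>))"]) (auto simp: mfps_act_GL_Gal_one)
  then have "mfps_act (A, \<sigma>) \<in> ring_iso ring_of_type_algebra ring_of_type_algebra"
    using mfps_act_hom[OF \<sigma>, of A] by (simp add: ring_iso_def ring_of_type_algebra_def)
  then have P: "?P (mfps_act (A, \<sigma>))"
    by (auto simp: mfps_act_const[OF \<sigma>] mfps_act_var[OF \<sigma>] linear_form_def
        intro: mfps_act_continuous[OF \<sigma>])
  show ?thesis
  proof
    assume "?P \<phi>"
    then show "\<phi> = mfps_act (A, \<sigma>)"
      using P by (intro mfps_hom_ext) (auto simp: ring_iso_def)
  qed (use P in simp)
qed

lemma linear_part_normal:
  fixes G :: "('l::field, 'd::finite) semilinear set"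
  assumes "subgroup G (GL_Gal K)"
  shows "linear_part G \<times> {id} \<lhd> GL_Gal K\<lparr>carrier := G\<rparr>"
proof -
  interpret \<Gamma>: group "GL_Gal K :: ('l, 'd) semilinear monoid" by (rule group_GL_Gal)
  interpret G: group "GL_Gal K\<lparr>carrier := G\<rparr>"
    by (rule \<Gamma>.subgroup_imp_group[OF assms])
  define Q :: "('l \<Rightarrow> 'l) monoid" where "Q = \<lparr>carrier = Gal K, monoid.mult = (\<circ>), one = id\<rparr>"
  have "group Q"
  proof (rule groupI)
    fix x assume x: "x \<in> carrier Q"
    then have "inv_into UNIV x \<in> Gal K" "inv_into UNIV x \<circ> x = id"
      by (auto simp: Q_def Gal_inv) (auto simp: Gal_def field_ring_iso_iff bij_is_inj)
    then show "\<exists>y\<in>carrier Q. y \<otimes>\<^bsub>Q\<^esub> x = \<one>\<^bsub>Q\<^esub>" by (auto simp: Q_def)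
  qed (auto simp: Q_def Gal_comp comp_assoc, auto simp: Gal_def field_ring_iso_iff)
  then interpret Q: group Q .
  have "G \<subseteq> carrier (GL_Gal K)" using assms by (rule subgroup.subset)
  then interpret h: group_hom "GL_Gal K\<lparr>carrier := G\<rparr>" Q snd
    by unfold_locales (auto simp: hom_def GL_Gal_def Q_def)
  have "kernel (GL_Gal K\<lparr>carrier := G\<rparr>) Q snd = linear_part G \<times> {id}"
    by (auto simp: kernel_def Q_def linear_part_def)
  then show ?thesis using h.normal_kernel by simp
qed

lemma skew_mult_superset:
  assumes "finite A" "Poly_Mapping.keys u \<subseteq> A" "finite B" "Poly_Mapping.keys v \<subseteq> B"
    and "\<And>g. g \<in> Poly_Mapping.keys u \<Longrightarrow> act g 0 = 0"
  shows "u \<otimes>\<^bsub>skew_group_ring \<Gamma> act\<^esub> v = (\<Sum>g\<in>A. \<Sum>h\<in>B. Poly_Mapping.single (g \<otimes>\<^bsub>\<Gamma>\<^esub> h)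
          (Poly_Mapping.lookup u g * act g (Poly_Mapping.lookup v h)))"
proof -
  have "(\<Sum>g\<in>A. \<Sum>h\<in>B. Poly_Mapping.single (g \<otimes>\<^bsub>\<Gamma>\<^esub> h)
          (Poly_Mapping.lookup u g * act g (Poly_Mapping.lookup v h)))
    = (\<Sum>g\<in>Poly_Mapping.keys u. \<Sum>h\<in>B. Poly_Mapping.single (g \<otimes>\<^bsub>\<Gamma>\<^esub> h)
          (Poly_Mapping.lookup u g * act g (Poly_Mapping.lookup v h)))"
    using assms by (intro sum.mono_neutral_right) (auto simp: in_keys_iff)
  also have "\<dots> = (\<Sum>g\<in>Poly_Mapping.keys u. \<Sum>h\<in>Poly_Mapping.keys v. Poly_Mapping.single (g \<otimes>\<^bsub>\<Gamma>\<^esub> h)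
          (Poly_Mapping.lookup u g * act g (Poly_Mapping.lookup v h)))"
    using assms by (intro sum.cong refl sum.mono_neutral_right) (auto simp: in_keys_iff)
  finally show ?thesis by (simp add: skew_group_ring_def)
qed

lemma ring_skew_group_ring:
  fixes act :: "'g \<Rightarrow> 's::comm_ring_1 \<Rightarrow> 's"
  assumes "group \<Gamma>"
    and hom: "\<And>g. g \<in> carrier \<Gamma> \<Longrightarrow> act g \<in> ring_hom ring_of_type_algebra ring_of_type_algebra"
    and act_mult: "\<And>g h. g \<in> carrier \<Gamma> \<Longrightarrow> h \<in> carrier \<Gamma> \<Longrightarrow> act (g \<otimes>\<^bsub>\<Gamma>\<^esub> h) = act g \<circ> act h"
    and act_one: "act \<one>\<^bsub>\<Gamma>\<^esub> = id"
  shows "ring (skew_group_ring \<Gamma> act)"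
proof -
  interpret group \<Gamma> by fact
  let ?S = "skew_group_ring \<Gamma> act"
  have a: "act g (x + y) = act g x + act g y" "act g (x * y) = act g x * act g y" "act g 1 = 1"
    if "g \<in> carrier \<Gamma>" for g x y
    using hom[OF that] by (auto simp: ring_hom_def ring_of_type_algebra_def)
  have a0: "act g 0 = 0" if "g \<in> carrier \<Gamma>" for g
    by (metis a(1)[OF that] add_0 add_cancel_right_right)
  have S: "carrier ?S = {u. Poly_Mapping.keys u \<subseteq> carrier \<Gamma>}" "\<one>\<^bsub>?S\<^esub> = Poly_Mapping.single \<one>\<^bsub>\<Gamma>\<^esub> 1"
    "\<zero>\<^bsub>?S\<^esub> = 0" "u \<oplus>\<^bsub>?S\<^esub> v = u + v" for u v
    by (simp_all add: skew_group_ring_def)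
  have single_mult: "Poly_Mapping.single g s \<otimes>\<^bsub>?S\<^esub> Poly_Mapping.single h t =
      Poly_Mapping.single (g \<otimes>\<^bsub>\<Gamma>\<^esub> h) (s * act g t)" if "g \<in> carrier \<Gamma>" for g h s t
    using that
    by (subst skew_mult_superset[of "{g}" _ "{h}"]) (auto simp: a0 split: if_splits)
  have add_closed: "u + v \<in> carrier ?S" if "u \<in> carrier ?S" "v \<in> carrier ?S" for u v
    using that Poly_Mapping.keys_add[of u v] by (auto simp: S)
  have z: "0 \<in> carrier ?S" by (simp add: S)
  have sum_closed: "sum f A \<in> carrier ?S" if "\<And>x. x \<in> A \<Longrightarrow> f x \<in> carrier ?S" for f :: "'g \<Rightarrow> _" and A
    using that by (induction A rule: infinite_finite_induct) (auto intro: add_closed z)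
  have single_closed: "Poly_Mapping.single g s \<in> carrier ?S" if "g \<in> carrier \<Gamma>" for g s
    using that by (auto simp: S split: if_splits)
  have dl: "(u + v) \<otimes>\<^bsub>?S\<^esub> w = u \<otimes>\<^bsub>?S\<^esub> w + v \<otimes>\<^bsub>?S\<^esub> w"
    if "u \<in> carrier ?S" "v \<in> carrier ?S" for u v w
  proof -
    let ?A = "Poly_Mapping.keys u \<union> Poly_Mapping.keys v"
    have sup: "x \<otimes>\<^bsub>?S\<^esub> w = (\<Sum>g\<in>?A. \<Sum>h\<in>Poly_Mapping.keys w. Poly_Mapping.single (g \<otimes>\<^bsub>\<Gamma>\<^esub> h)
          (Poly_Mapping.lookup x g * act g (Poly_Mapping.lookup w h)))"
      if "Poly_Mapping.keys x \<subseteq> ?A" for x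
      using that \<open>u \<in> carrier ?S\<close> \<open>v \<in> carrier ?S\<close>
      by (intro skew_mult_superset) (auto simp: S intro!: a0)
    show ?thesis
      using Poly_Mapping.keys_add[of u v]
      by (simp add: sup lookup_add distrib_right single_add sum.distrib)
  qed
  have dr: "w \<otimes>\<^bsub>?S\<^esub> (u + v) = w \<otimes>\<^bsub>?S\<^esub> u + w \<otimes>\<^bsub>?S\<^esub> v" if "w \<in> carrier ?S" for u v w
  proof -
    let ?A = "Poly_Mapping.keys u \<union> Poly_Mapping.keys v"
    have sup: "w \<otimes>\<^bsub>?S\<^esub> x = (\<Sum>g\<in>Poly_Mapping.keys w. \<Sum>h\<in>?A. Poly_Mapping.single (g \<otimes>\<^bsub>\<Gamma>\<^esub> h)
          (Poly_Mapping.lookup w g * act g (Poly_Mapping.lookup x h)))"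
      if "Poly_Mapping.keys x \<subseteq> ?A" for x
      using that \<open>w \<in> carrier ?S\<close> by (intro skew_mult_superset) (auto simp: S intro!: a0)
    have "(\<Sum>g\<in>Poly_Mapping.keys w. \<Sum>h\<in>?A. Poly_Mapping.single (g \<otimes>\<^bsub>\<Gamma>\<^esub> h)
          (Poly_Mapping.lookup w g * act g (Poly_Mapping.lookup (u + v) h))) =
        (\<Sum>g\<in>Poly_Mapping.keys w. \<Sum>h\<in>?A. Poly_Mapping.single (g \<otimes>\<^bsub>\<Gamma>\<^esub> h)
          (Poly_Mapping.lookup w g * act g (Poly_Mapping.lookup u h)) +
          Poly_Mapping.single (g \<otimes>\<^bsub>\<Gamma>\<^esub> h)
          (Poly_Mapping.lookup w g * act g (Poly_Mapping.lookup v h)))"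
    proof (intro sum.cong refl)
      fix g h assume "g \<in> Poly_Mapping.keys w"
      then have "g \<in> carrier \<Gamma>" using that by (auto simp: S)
      then show "Poly_Mapping.single (g \<otimes>\<^bsub>\<Gamma>\<^esub> h)
          (Poly_Mapping.lookup w g * act g (Poly_Mapping.lookup (u + v) h)) =
          Poly_Mapping.single (g \<otimes>\<^bsub>\<Gamma>\<^esub> h)
          (Poly_Mapping.lookup w g * act g (Poly_Mapping.lookup u h)) +
          Poly_Mapping.single (g \<otimes>\<^bsub>\<Gamma>\<^esub> h)
          (Poly_Mapping.lookup w g * act g (Poly_Mapping.lookup v h))"
        by (simp add: lookup_add a distrib_left single_add)
    qed
    then show ?thesis
      using Poly_Mapping.keys_add[of u v] by (simp add: sup sum.distrib)
  qed
  have decomp: "u = (\<Sum>g\<in>Poly_Mapping.keys u. Poly_Mapping.single g (Poly_Mapping.lookup u g))" for u :: "'g \<Rightarrow>\<^sub>0 's"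
    by (rule poly_mapping_eqI) (simp add: lookup_sum lookup_single when_def in_keys_iff)
  have ind: "P u" if u: "u \<in> carrier ?S" and P0: "P 0"
    and step: "\<And>g s v. g \<in> carrier \<Gamma> \<Longrightarrow> v \<in> carrier ?S \<Longrightarrow> P v \<Longrightarrow> P (Poly_Mapping.single g s + v)" for P u
  proof -
    have "P (\<Sum>g\<in>A. Poly_Mapping.single g (Poly_Mapping.lookup u g))"
      if "finite A" "A \<subseteq> carrier \<Gamma>" for A
      using that
    proof induction
      case (insert g A)
      have "(\<Sum>g\<in>A. Poly_Mapping.single g (Poly_Mapping.lookup u g)) \<in> carrier ?S"
        by (rule sum_closed) (use insert in \<open>auto intro!: single_closed\<close>)
      then show ?case using insert step by auto
    qed (use P0 in simp)
    from this[of "Poly_Mapping.keys u"] show ?thesis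
      using decomp[of u] u by (simp add: S)
  qed
  have zl: "0 \<otimes>\<^bsub>?S\<^esub> u = 0" for u by (simp add: skew_group_ring_def)
  have zr: "u \<otimes>\<^bsub>?S\<^esub> 0 = 0" for u by (simp add: skew_group_ring_def)
  have closed1: "Poly_Mapping.single g s \<otimes>\<^bsub>?S\<^esub> v \<in> carrier ?S"
    if "g \<in> carrier \<Gamma>" "v \<in> carrier ?S" for g s v
    using that(2)
  proof (rule ind)
    fix h t w assume "h \<in> carrier \<Gamma>" "Poly_Mapping.single g s \<otimes>\<^bsub>?S\<^esub> w \<in> carrier ?S"
    then show "Poly_Mapping.single g s \<otimes>\<^bsub>?S\<^esub> (Poly_Mapping.single h t + w) \<in> carrier ?S"
      using that by (auto simp: dr single_closed single_mult intro!: add_closed)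
  qed (simp add: zr z)
  have closed: "u \<otimes>\<^bsub>?S\<^esub> v \<in> carrier ?S" if "u \<in> carrier ?S" "v \<in> carrier ?S" for u v
    using that(1)
  proof (rule ind)
    fix g s w assume "g \<in> carrier \<Gamma>" "w \<in> carrier ?S" "w \<otimes>\<^bsub>?S\<^esub> v \<in> carrier ?S"
    then show "(Poly_Mapping.single g s + w) \<otimes>\<^bsub>?S\<^esub> v \<in> carrier ?S"
      using that by (auto simp: dl single_closed intro!: add_closed closed1)
  qed (simp add: zl z)
  have assoc: "u \<otimes>\<^bsub>?S\<^esub> v \<otimes>\<^bsub>?S\<^esub> w = u \<otimes>\<^bsub>?S\<^esub> (v \<otimes>\<^bsub>?S\<^esub> w)"
    if uvw: "u \<in> carrier ?S" "v \<in> carrier ?S" "w \<in> carrier ?S" for u v w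
    using uvw(1)
  proof (rule ind)
    fix g s u' assume g: "g \<in> carrier \<Gamma>" and u': "u' \<in> carrier ?S"
      "u' \<otimes>\<^bsub>?S\<^esub> v \<otimes>\<^bsub>?S\<^esub> w = u' \<otimes>\<^bsub>?S\<^esub> (v \<otimes>\<^bsub>?S\<^esub> w)"
    have "Poly_Mapping.single g s \<otimes>\<^bsub>?S\<^esub> v \<otimes>\<^bsub>?S\<^esub> w = Poly_Mapping.single g s \<otimes>\<^bsub>?S\<^esub> (v \<otimes>\<^bsub>?S\<^esub> w)"
      using uvw(2)
    proof (rule ind)
      fix h t v' assume h: "h \<in> carrier \<Gamma>" and v': "v' \<in> carrier ?S"
        "Poly_Mapping.single g s \<otimes>\<^bsub>?S\<^esub> v' \<otimes>\<^bsub>?S\<^esub> w = Poly_Mapping.single g s \<otimes>\<^bsub>?S\<^esub> (v' \<otimes>\<^bsub>?S\<^esub> w)"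
      have "Poly_Mapping.single g s \<otimes>\<^bsub>?S\<^esub> Poly_Mapping.single h t \<otimes>\<^bsub>?S\<^esub> w =
          Poly_Mapping.single g s \<otimes>\<^bsub>?S\<^esub> (Poly_Mapping.single h t \<otimes>\<^bsub>?S\<^esub> w)"
        using uvw(3)
      proof (rule ind)
        fix k r w' assume k: "k \<in> carrier \<Gamma>" and w': "w' \<in> carrier ?S"
          "Poly_Mapping.single g s \<otimes>\<^bsub>?S\<^esub> Poly_Mapping.single h t \<otimes>\<^bsub>?S\<^esub> w' =
          Poly_Mapping.single g s \<otimes>\<^bsub>?S\<^esub> (Poly_Mapping.single h t \<otimes>\<^bsub>?S\<^esub> w')"
        then show "Poly_Mapping.single g s \<otimes>\<^bsub>?S\<^esub> Poly_Mapping.single h t \<otimes>\<^bsub>?S\<^esub> (Poly_Mapping.single k r + w') =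
          Poly_Mapping.single g s \<otimes>\<^bsub>?S\<^esub> (Poly_Mapping.single h t \<otimes>\<^bsub>?S\<^esub> (Poly_Mapping.single k r + w'))"
          using g h by (simp add: dr closed single_closed single_mult act_mult a m_assoc mult.assoc)
      qed (simp add: zr)
      then show "Poly_Mapping.single g s \<otimes>\<^bsub>?S\<^esub> (Poly_Mapping.single h t + v') \<otimes>\<^bsub>?S\<^esub> w =
          Poly_Mapping.single g s \<otimes>\<^bsub>?S\<^esub> ((Poly_Mapping.single h t + v') \<otimes>\<^bsub>?S\<^esub> w)"
        using g h v' uvw by (simp add: dl dr single_closed closed)
    qed (simp add: zl zr)
    then show "(Poly_Mapping.single g s + u') \<otimes>\<^bsub>?S\<^esub> v \<otimes>\<^bsub>?S\<^esub> w = (Poly_Mapping.single g s + u') \<otimes>\<^bsub>?S\<^esub> (v \<otimes>\<^bsub>?S\<^esub> w)"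
      using g u' uvw by (simp add: dl single_closed closed)
  qed (simp add: zl)
  have one_closed: "\<one>\<^bsub>?S\<^esub> \<in> carrier ?S" using single_closed[of "\<one>\<^bsub>\<Gamma>\<^esub>" 1] by (simp add: S)
  have one_l: "\<one>\<^bsub>?S\<^esub> \<otimes>\<^bsub>?S\<^esub> u = u" if "u \<in> carrier ?S" for u
    using that
  proof (rule ind)
    fix g s v assume "g \<in> carrier \<Gamma>" "\<one>\<^bsub>?S\<^esub> \<otimes>\<^bsub>?S\<^esub> v = v"
    then show "\<one>\<^bsub>?S\<^esub> \<otimes>\<^bsub>?S\<^esub> (Poly_Mapping.single g s + v) = Poly_Mapping.single g s + v"
      by (simp add: S(2) dr single_closed single_mult act_one)
  qed (simp add: zr)
  have one_r: "u \<otimes>\<^bsub>?S\<^esub> \<one>\<^bsub>?S\<^esub> = u" if "u \<in> carrier ?S" for u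
    using that
  proof (rule ind)
    fix g s v assume "g \<in> carrier \<Gamma>" "v \<in> carrier ?S" "v \<otimes>\<^bsub>?S\<^esub> \<one>\<^bsub>?S\<^esub> = v"
    then show "(Poly_Mapping.single g s + v) \<otimes>\<^bsub>?S\<^esub> \<one>\<^bsub>?S\<^esub> = Poly_Mapping.single g s + v"
      by (simp add: S(2) dl single_closed single_mult a)
  qed (simp add: zl)
  show ?thesis
  proof (rule ringI)
    show "abelian_group ?S"
    proof (rule abelian_groupI)
      fix u assume "u \<in> carrier ?S"
      then have "- u \<in> carrier ?S" by (simp add: S)
      then show "\<exists>y\<in>carrier ?S. y \<oplus>\<^bsub>?S\<^esub> u = \<zero>\<^bsub>?S\<^esub>" by (auto simp: S(3,4) intro!: bexI[of _ "- u"])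
    qed (auto simp: S(3,4) add_closed z add_ac)
    show "monoid ?S"
      by unfold_locales (auto simp: closed assoc one_closed one_l one_r)
  qed (auto simp: S(4) dl dr)
qed

lemma ring_End_ring: "ring (End_ring R)"
proof (rule ringI)
  show "abelian_group (End_ring R)"
  proof (rule abelian_groupI)
    fix \<phi> assume "\<phi> \<in> carrier (End_ring R)"
    then show "\<exists>y\<in>carrier (End_ring R). y \<oplus>\<^bsub>End_ring R\<^esub> \<phi> = \<zero>\<^bsub>End_ring R\<^esub>"
      by (intro bexI[of _ "\<lambda>s. - \<phi> s"]) (auto simp: End_ring_def)
  qed (auto simp: End_ring_def algebra_simps)
  show "monoid (End_ring R)"
    by unfold_locales (auto simp: End_ring_def)
qed (auto simp: End_ring_def)

lemma ring_skew_mfps: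
  assumes "subgroup G (GL_Gal K)"
  shows "ring (skew_group_ring (GL_Gal K\<lparr>carrier := G\<rparr>) mfps_act)"
proof (rule ring_skew_group_ring)
  show "group (GL_Gal K\<lparr>carrier := G\<rparr>)"
    by (rule group.subgroup_imp_group[OF group_GL_Gal assms])
  have sub: "g \<in> carrier (GL_Gal K)" if "g \<in> G" for g
    using subgroup.subset[OF assms] that by blast
  fix g h assume g: "g \<in> carrier (GL_Gal K\<lparr>carrier := G\<rparr>)"
  then show "mfps_act g \<in> ring_hom ring_of_type_algebra ring_of_type_algebra"
    using sub[of g] by (cases g) (auto simp: GL_Gal_def intro: mfps_act_hom Gal_iso)
  assume "h \<in> carrier (GL_Gal K\<lparr>carrier := G\<rparr>)"
  then show "mfps_act (g \<otimes>\<^bsub>GL_Gal K\<lparr>carrier := G\<rparr>\<^esub> h) = mfps_act g \<circ> mfps_act h"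
    using g sub by (simp add: mfps_act_GL_Gal_mult)
qed (simp add: mfps_act_GL_Gal_one)

lemma skew_to_End_single:
  "act g 0 = 0 \<Longrightarrow> skew_to_End act (Poly_Mapping.single g s) = (\<lambda>t. s * act g t)"
  by (auto simp: skew_to_End_def)

end

theory Submission
  imports Defs
begin

text \<open>
  Call \<open>a, b\<close> a regular pair if \<open>a \<noteq> 0\<close> and \<open>b\<close> is a non-zero-divisor modulo \<open>a\<close>. Smallness of the
  linear part says that for \<open>g \<noteq> 1\<close> in \<open>G\<close> there are \<open>s, t\<close> such that \<open>g s - s, g t - t\<close> is a
  regular pair: two independent linear forms if \<open>g\<close> is linear, a unit and \<open>0\<close> otherwise. Injectivity
  of \<open>S * G \<rightarrow> End S\<close> is independence of characters. For surjectivity, expand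
  \<open>\<Prod>\<^sub>g (g t\<^sub>g - h t\<^sub>g)\<close>, the product running over \<open>g \<noteq> 1\<close>, as \<open>\<Sum>\<^sub>i a\<^sub>i h(b\<^sub>i)\<close>; it vanishes for \<open>h \<noteq> 1\<close>, and
  is \<open>f = \<Prod>\<^sub>g (g t\<^sub>g - t\<^sub>g)\<close> for \<open>h = 1\<close>. Hence \<open>f x = \<Sum>\<^sub>i a\<^sub>i Tr(b\<^sub>i x)\<close>, and an \<open>S\<^sup>G\<close>-linear
  \<open>\<phi>\<close> satisfies \<open>\<phi> (f x) = \<Sum>\<^sub>h (\<Sum>\<^sub>i \<phi>(a\<^sub>i) h(b\<^sub>i)) h(x)\<close>, so that \<open>\<phi> \<circ> f\<close> comes from \<open>S * G\<close>.
  As each \<open>t\<^sub>g\<close> may be either of the two elements provided by the regular pair for \<open>g\<close>, the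
  factors of \<open>f\<close> can be cancelled one after the other.
\<close>

section \<open>Regular pairs\<close>

text \<open>A regular sequence of length two, except that \<open>a\<close> and \<open>b\<close> may
  generate the unit ideal. A unit \<open>a\<close> thus pairs with every \<open>b\<close>, so that
  elements moving a constant fit into the same framework.\<close>

definition regular_pair :: "'s::comm_ring_1 \<Rightarrow> 's \<Rightarrow> bool"
  where "regular_pair a b \<longleftrightarrow> a \<noteq> 0 \<and> (\<forall>u v. a * u = b * v \<longrightarrow> a dvd v)"

lemma regular_pairD: "regular_pair a b \<Longrightarrow> a * u = b * v \<Longrightarrow> a dvd v"
  by (auto simp: regular_pair_def)

lemma regular_pair_unit: "a dvd 1 \<Longrightarrow> regular_pair (a :: 's::comm_ring_1) b"
  by (auto simp: regular_pair_def dvd_def) (metis mult.assoc mult.left_commute mult_1)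

text \<open>Used for \<open>act g\<close> when factors are cancelled, and for the linear
  substitution that carries two variables to two independent linear forms.\<close>

lemma regular_pair_image:
  fixes \<phi> :: "'s::comm_ring_1 \<Rightarrow> 's"
  assumes "bij \<phi>" and mult: "\<And>x y. \<phi> (x * y) = \<phi> x * \<phi> y" and zero: "\<phi> 0 = 0"
    and reg: "regular_pair a b"
  shows "regular_pair (\<phi> a) (\<phi> b)"
  unfolding regular_pair_def
proof (intro conjI allI impI)
  show "\<phi> a \<noteq> 0"
    using assms by (metis bij_is_inj injD regular_pair_def)
  fix u v assume eq: "\<phi> a * u = \<phi> b * v"
  obtain u' v' where u': "u = \<phi> u'" "v = \<phi> v'"
    using \<open>bij \<phi>\<close> by (metis bij_pointE)
  then have "a * u' = b * v'"
    using eq \<open>bij \<phi>\<close> by (metis bij_is_inj injD mult)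
  then obtain w where "v' = a * w"
    using regular_pairD[OF reg] by blast
  then show "\<phi> a dvd v"
    using u' by (simp add: mult)
qed

text \<open>Dedekind's argument: replace \<open>t\<close> by \<open>x * t\<close> in the relation
  and subtract \<open>\<psi> k x\<close> times the relation. This removes the term of
  \<open>k\<close> and multiplies \<open>c h\<close> by \<open>\<psi> h x - \<psi> k x\<close>,
  which is nonzero for a suitable \<open>x\<close>.\<close>

lemma independent_characters:
  fixes \<psi> :: "'g \<Rightarrow> 's::monoid_mult \<Rightarrow> 'r::idom"
  assumes "finite Y" "\<And>h. h \<in> Y \<Longrightarrow> \<psi> h 1 = 1"
    and "\<And>h x y. h \<in> Y \<Longrightarrow> \<psi> h (x * y) = \<psi> h x * \<psi> h y"
    and "inj_on \<psi> Y"
    and "\<And>t. (\<Sum>h\<in>Y. c h * \<psi> h t) = 0"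
    and "h \<in> Y"
  shows "c h = 0"
  using assms
proof (induction Y arbitrary: c h rule: finite_induct)
  case (insert k Y)
  note one = insert.prems(1) and mult = insert.prems(2) and zero = insert.prems(4)
  have c0: "c h = 0" if h: "h \<in> Y" for h
  proof -
    have "\<psi> h \<noteq> \<psi> k"
      using insert.prems(3) insert.hyps h by (auto simp: inj_on_def)
    then obtain x where x: "\<psi> h x \<noteq> \<psi> k x" by blast
    have "c h * (\<psi> h x - \<psi> k x) = 0"
    proof (rule insert.IH[of "\<lambda>h. c h * (\<psi> h x - \<psi> k x)" h])
      fix t
      have "(\<Sum>h\<in>Y. c h * (\<psi> h x - \<psi> k x) * \<psi> h t) = (\<Sum>h\<in>insert k Y. c h * (\<psi> h x - \<psi> k x) * \<psi> h t)"
        using insert.hyps by simp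
      also have "\<dots> = (\<Sum>h\<in>insert k Y. c h * \<psi> h (x * t)) - \<psi> k x * (\<Sum>h\<in>insert k Y. c h * \<psi> h t)"
        unfolding sum_distrib_left sum_subtractf[symmetric]
        by (intro sum.cong) (auto simp: mult algebra_simps)
      also have "\<dots> = 0" by (simp only: zero) simp
      finally show "(\<Sum>h\<in>Y. c h * (\<psi> h x - \<psi> k x) * \<psi> h t) = 0" .
    qed (use insert.prems h in \<open>auto simp: inj_on_def\<close>)
    then show ?thesis using x by simp
  qed
  moreover have "c k = 0"
    using zero[of 1] insert.hyps c0 one by simp
  ultimately show ?case using insert.prems(5) by auto
qed simp

section \<open>Actions unramified in codimension one\<close>

text \<open>The last assumption replaces smallness. Over a Noetherian ring it implies that no prime
  of height one contains all \<open>act g s - s\<close>, so primes of height one have trivial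
  inertia.\<close>

locale unramified_action = group \<Gamma> for \<Gamma> :: "('g, 'm) monoid_scheme" (structure) +
  fixes act :: "'g \<Rightarrow> 's::idom \<Rightarrow> 's"
  assumes finite_carrier: "finite (carrier \<Gamma>)"
    and act_hom: "\<And>g. g \<in> carrier \<Gamma> \<Longrightarrow> act g \<in> ring_hom ring_of_type_algebra ring_of_type_algebra"
    and act_mult: "\<And>g h. g \<in> carrier \<Gamma> \<Longrightarrow> h \<in> carrier \<Gamma> \<Longrightarrow> act (g \<otimes> h) = act g \<circ> act h"
    and act_one: "act \<one> = id"
    and unramified: "\<And>g. g \<in> carrier \<Gamma> \<Longrightarrow> g \<noteq> \<one> \<Longrightarrow> \<exists>s t. regular_pair (act g s - s) (act g t - t)"
begin

section \<open>Elementary properties of the action\<close>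

lemma act_simps:
  assumes "g \<in> carrier \<Gamma>"
  shows "act g (x + y) = act g x + act g y" "act g (x * y) = act g x * act g y" "act g 1 = 1"
  using act_hom[OF assms] by (auto simp: ring_hom_def ring_of_type_algebra_def)

lemma act_zero: "g \<in> carrier \<Gamma> \<Longrightarrow> act g 0 = 0"
  by (metis act_simps(1) add_0 add_cancel_right_right)

lemma act_minus: "g \<in> carrier \<Gamma> \<Longrightarrow> act g (- x) = - act g x"
  by (metis act_simps(1) act_zero add.inverse_unique right_minus)

lemma act_sum: "g \<in> carrier \<Gamma> \<Longrightarrow> act g (sum u A) = (\<Sum>x\<in>A. act g (u x))"
  by (induction A rule: infinite_finite_induct) (auto simp: act_zero act_simps)

lemma act_prod: "g \<in> carrier \<Gamma> \<Longrightarrow> act g (prod u A) = (\<Prod>x\<in>A. act g (u x))"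
  by (induction A rule: infinite_finite_induct) (auto simp: act_simps)

lemma act_inv:
  assumes "g \<in> carrier \<Gamma>"
  shows "act g (act (inv g) x) = x" "act (inv g) (act g x) = x"
  using act_mult[of g "inv g"] act_mult[of "inv g" g] assms
  by (simp_all add: act_one fun_eq_iff)

lemma bij_act: "g \<in> carrier \<Gamma> \<Longrightarrow> bij (act g)"
  by (rule o_bij[of "act (inv g)"]) (auto simp: act_inv)

lemma act_eq_0_iff: "g \<in> carrier \<Gamma> \<Longrightarrow> act g x = 0 \<longleftrightarrow> x = 0"
  by (metis act_inv(2) act_zero inv_closed)

text \<open>The first entry of a regular pair is nonzero, so only the neutral element acts as the
  identity. Independence of characters needs this.\<close>

lemma inj_on_act: "inj_on act (carrier \<Gamma>)"
proof (rule inj_onI)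
  fix g h assume gh: "g \<in> carrier \<Gamma>" "h \<in> carrier \<Gamma>" "act g = act h"
  have "act (inv g \<otimes> h) = id"
    using gh act_mult[of "inv g" h] by (auto simp: fun_eq_iff act_inv simp flip: gh(3))
  then have "inv g \<otimes> h = \<one>"
    using unramified[of "inv g \<otimes> h"] gh by (auto simp: regular_pair_def)
  then show "g = h"
    using gh by (metis inv_closed inv_equality inv_inv)
qed

text \<open>The endomorphism induced by the element of the skew group ring with coefficients
  \<open>c\<close>. Total coefficient functions avoid supports; values outside the group are
  ignored.\<close>

definition combination :: "('g \<Rightarrow> 's) \<Rightarrow> 's \<Rightarrow> 's"
  where "combination c t = (\<Sum>g\<in>carrier \<Gamma>. c g * act g t)"

lemma combination_inject:
  assumes "combination c = combination e" "g \<in> carrier \<Gamma>"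
  shows "c g = e g"
proof -
  have "c g - e g = 0"
  proof (rule independent_characters[of "carrier \<Gamma>" act "\<lambda>g. c g - e g"])
    show "(\<Sum>h\<in>carrier \<Gamma>. (c h - e h) * act h t) = 0" for t
      using fun_cong[OF assms(1), of t]
      by (simp add: combination_def left_diff_distrib sum_subtractf)
  qed (use assms finite_carrier inj_on_act in \<open>auto simp: act_simps\<close>)
  then show ?thesis by simp
qed

section \<open>Endomorphisms linear over the invariants\<close>

definition inv_ring :: "'s set"
  where "inv_ring = {s. \<forall>g\<in>carrier \<Gamma>. act g s = s}"

abbreviation linear_endo :: "('s \<Rightarrow> 's) \<Rightarrow> bool"
  where "linear_endo \<phi> \<equiv> \<phi> \<in> carrier (End_ring inv_ring)"

lemma linear_endo_add: "linear_endo \<phi> \<Longrightarrow> \<phi> (s + t) = \<phi> s + \<phi> t"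
  by (simp add: End_ring_def)

lemma linear_endo_scale: "linear_endo \<phi> \<Longrightarrow> r \<in> inv_ring \<Longrightarrow> \<phi> (r * s) = r * \<phi> s"
  by (simp add: End_ring_def)

lemma linear_endo_sum:
  assumes "linear_endo \<phi>" shows "\<phi> (sum u A) = (\<Sum>x\<in>A. \<phi> (u x))"
proof -
  have "\<phi> 0 = 0" by (metis linear_endo_add[OF assms] add_0 add_cancel_right_right)
  then show ?thesis
    by (induction A rule: infinite_finite_induct) (auto simp: linear_endo_add[OF assms])
qed

lemma linear_endo_comp_mult: "linear_endo \<phi> \<Longrightarrow> linear_endo (\<lambda>t. \<phi> (a * t))"
  by (auto simp: End_ring_def distrib_left mult.left_commute)

lemma linear_endo_combination: "linear_endo (combination c)"
  by (auto simp: End_ring_def combination_def act_simps inv_ring_def sum.distrib sum_distrib_left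
      algebra_simps intro!: sum.cong)

lemma linear_endo_diff: "linear_endo \<phi> \<Longrightarrow> linear_endo \<psi> \<Longrightarrow> linear_endo (\<lambda>t. \<phi> t - \<psi> t)"
  by (auto simp: End_ring_def algebra_simps)

lemma bij_left_mult: "h \<in> carrier \<Gamma> \<Longrightarrow> bij_betw (\<lambda>g. h \<otimes> g) (carrier \<Gamma>) (carrier \<Gamma>)"
  by (rule bij_betwI[of _ _ _ "\<lambda>g. inv h \<otimes> g"]) (auto simp: m_assoc[symmetric])

lemma trace_in_inv_ring: "(\<Sum>g\<in>carrier \<Gamma>. act g x) \<in> inv_ring"
  unfolding inv_ring_def
proof clarify
  fix h assume h: "h \<in> carrier \<Gamma>"
  have "act h (\<Sum>g\<in>carrier \<Gamma>. act g x) = (\<Sum>g\<in>carrier \<Gamma>. act (h \<otimes> g) x)"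
    using h by (simp add: act_sum act_mult)
  also have "\<dots> = (\<Sum>g\<in>carrier \<Gamma>. act g x)"
    using bij_left_mult[OF h] by (rule sum.reindex_bij_betw)
  finally show "act h (\<Sum>g\<in>carrier \<Gamma>. act g x) = (\<Sum>g\<in>carrier \<Gamma>. act g x)" .
qed

lemma norm_in_inv_ring: "(\<Prod>g\<in>carrier \<Gamma>. act g x) \<in> inv_ring"
  unfolding inv_ring_def
proof clarify
  fix h assume h: "h \<in> carrier \<Gamma>"
  have "act h (\<Prod>g\<in>carrier \<Gamma>. act g x) = (\<Prod>g\<in>carrier \<Gamma>. act (h \<otimes> g) x)"
    using h by (simp add: act_prod act_mult)
  also have "\<dots> = (\<Prod>g\<in>carrier \<Gamma>. act g x)"
    using bij_left_mult[OF h] by (rule prod.reindex_bij_betw)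
  finally show "act h (\<Prod>g\<in>carrier \<Gamma>. act g x) = (\<Prod>g\<in>carrier \<Gamma>. act g x)" .
qed

text \<open>The norm of \<open>a\<close> is a nonzero invariant multiple \<open>a * b\<close>, hence
  it times \<open>\<phi> t\<close> is \<open>\<phi> (a * (b * t)) = 0\<close>.\<close>

lemma linear_endo_eq_zero:
  assumes \<phi>: "linear_endo \<phi>" and "a \<noteq> 0" and zero: "\<And>t. \<phi> (a * t) = 0"
  shows "\<phi> t = 0"
proof -
  let ?N = "\<Prod>g\<in>carrier \<Gamma>. act g a"
  have "a dvd ?N"
    using dvd_prodI[OF finite_carrier, of \<one> "\<lambda>g. act g a"] by (simp add: act_one)
  then obtain b where "?N = a * b" by blast
  then have "?N * \<phi> t = 0"
    using linear_endo_scale[OF \<phi> norm_in_inv_ring] zero by (metis mult.assoc)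
  moreover have "?N \<noteq> 0"
    using finite_carrier \<open>a \<noteq> 0\<close> by (auto simp: act_eq_0_iff)
  ultimately show ?thesis by simp
qed

text \<open>Computing \<open>\<phi> (a * (b * t))\<close> in two ways and comparing coefficients
  gives \<open>c g * act g b = e g * act g a\<close>. As \<open>act g a, act g b\<close> is again a
  regular pair, \<open>act g a\<close> divides \<open>c g\<close>; the quotients are the
  coefficients of \<open>\<phi>\<close>.\<close>

lemma combination_cancel_regular_pair:
  assumes \<phi>: "linear_endo \<phi>" and reg: "regular_pair a b"
    and a: "(\<lambda>t. \<phi> (a * t)) \<in> range combination" and b: "(\<lambda>t. \<phi> (b * t)) \<in> range combination"
  shows "\<phi> \<in> range combination"
proof -
  obtain c where c: "\<phi> (a * t) = combination c t" for t using a by (auto simp: fun_eq_iff)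
  obtain e where e: "\<phi> (b * t) = combination e t" for t using b by (auto simp: fun_eq_iff)
  have "combination (\<lambda>g. c g * act g b) t = \<phi> (a * (b * t))" for t
    unfolding c by (auto simp: combination_def act_simps mult.assoc intro!: sum.cong)
  moreover have "combination (\<lambda>g. e g * act g a) t = \<phi> (b * (a * t))" for t
    unfolding e by (auto simp: combination_def act_simps mult.assoc intro!: sum.cong)
  ultimately have "combination (\<lambda>g. c g * act g b) = combination (\<lambda>g. e g * act g a)"
    by (simp add: fun_eq_iff mult.left_commute)
  then have eq: "c g * act g b = e g * act g a" if "g \<in> carrier \<Gamma>" for g
    using combination_inject that by blast
  have "act g a dvd c g" if g: "g \<in> carrier \<Gamma>" for g
  proof (rule regular_pairD)
    show "regular_pair (act g a) (act g b)"
      by (rule regular_pair_image) (use g reg in \<open>auto simp: bij_act act_simps act_zero\<close>)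
    show "act g a * e g = act g b * c g" using eq[OF g] by (simp add: mult.commute)
  qed
  then obtain q where q: "c g = act g a * q g" if "g \<in> carrier \<Gamma>" for g
    unfolding dvd_def by metis
  \<comment> \<open>Agreement on the multiples of \<open>a\<close> suffices: the difference is
    linear over the invariants.\<close>
  have "\<phi> (a * t) - combination q (a * t) = 0" for t
    unfolding c by (auto simp: combination_def q act_simps algebra_simps intro!: sum.cong)
  moreover have "a \<noteq> 0" using reg by (simp add: regular_pair_def)
  ultimately have "\<phi> t - combination q t = 0" for t
    using linear_endo_eq_zero[OF linear_endo_diff[OF \<phi> linear_endo_combination]] by blast
  then have "\<phi> = combination q" by (simp add: fun_eq_iff)
  then show ?thesis by blast
qed

text \<open>Both entries of a regular pair are needed to cancel one factor, so the last hypothesis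
  ranges over all choices \<open>u\<close>. The induction hypothesis is applied to
  \<open>\<phi>\<close> precomposed with multiplication by the factor of \<open>k\<close>, once for
  each choice there.\<close>

lemma combination_cancel_prod:
  assumes "finite Y"
    and "\<And>g. g \<in> Y \<Longrightarrow> regular_pair (act g (s g) - s g) (act g (t g) - t g)"
    and "linear_endo \<phi>"
    and "\<And>u. (\<And>g. g \<in> Y \<Longrightarrow> u g \<in> {s g, t g}) \<Longrightarrow>
      (\<lambda>x. \<phi> ((\<Prod>g\<in>Y. act g (u g) - u g) * x)) \<in> range combination"
  shows "\<phi> \<in> range combination"
  using assms
proof (induction Y arbitrary: \<phi> rule: finite_induct)
  case (insert k Y)
  have step: "(\<lambda>x. \<phi> ((act k w - w) * x)) \<in> range combination" if w: "w \<in> {s k, t k}" for w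
  proof (rule insert.IH)
    fix u assume u: "\<And>g. g \<in> Y \<Longrightarrow> u g \<in> {s g, t g}"
    have "(\<lambda>x. \<phi> ((\<Prod>g\<in>insert k Y. act g ((u(k := w)) g) - (u(k := w)) g) * x)) \<in> range combination"
      using u w by (intro insert.prems(3)) auto
    moreover have "(\<Prod>g\<in>Y. act g ((u(k := w)) g) - (u(k := w)) g) = (\<Prod>g\<in>Y. act g (u g) - u g)"
      using insert.hyps by (intro prod.cong) auto
    ultimately show "(\<lambda>x. \<phi> ((act k w - w) * ((\<Prod>g\<in>Y. act g (u g) - u g) * x))) \<in> range combination"
      using insert.hyps by (simp add: mult.assoc)
  qed (use insert.prems in \<open>auto intro: linear_endo_comp_mult\<close>)
  show ?case
    by (rule combination_cancel_regular_pair[OF insert.prems(2) insert.prems(1)[of k]])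
      (auto intro: step)
qed auto

lemma linear_endo_comp_prod:
  assumes \<phi>: "linear_endo \<phi>"
  shows "(\<lambda>x. \<phi> ((\<Prod>g\<in>carrier \<Gamma> - {\<one>}. act g (u g) - u g) * x)) \<in> range combination"
proof -
  let ?X = "carrier \<Gamma> - {\<one>}"
  define a where "a Z = (\<Prod>g\<in>Z. act g (u g))" for Z
  \<comment> \<open>\<open>Z\<close> collects the factors from which \<open>act g (u g)\<close> is
    taken when the product is expanded; only \<open>b Z\<close> is moved by
    \<open>h\<close>.\<close>
  define b where "b Z = (\<Prod>g\<in>?X - Z. - u g)" for Z
  define f where "f = (\<Prod>g\<in>?X. act g (u g) - u g)"
  have expand: "(\<Sum>Z\<in>Pow ?X. a Z * act h (b Z)) = (\<Prod>g\<in>?X. act g (u g) - act h (u g))"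
    if h: "h \<in> carrier \<Gamma>" for h
  proof -
    have "(\<Prod>g\<in>?X. act g (u g) + act h (- u g)) = (\<Sum>Z\<in>Pow ?X. a Z * act h (b Z))"
      using finite_carrier h by (simp only: act_prod a_def b_def) (rule prod_add, simp)
    then show ?thesis using h by (simp add: act_minus)
  qed
  have delta: "(\<Sum>Z\<in>Pow ?X. a Z * act h (b Z)) = (if h = \<one> then f else 0)"
    if h: "h \<in> carrier \<Gamma>" for h
  proof (cases "h = \<one>")
    case False
    \<comment> \<open>The factor at \<open>g = h\<close> vanishes.\<close>
    have "(\<Prod>g\<in>?X. act g (u g) - act h (u g)) = 0"
      using finite_carrier h False by auto
    then show ?thesis using False by (simp add: expand[OF h])
  qed (use expand[OF h] in \<open>simp add: f_def act_one\<close>)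
  have "\<phi> (f * x) = combination (\<lambda>h. \<Sum>Z\<in>Pow ?X. \<phi> (a Z) * act h (b Z)) x" for x
  proof -
    have "f * x = (\<Sum>h\<in>carrier \<Gamma>. if h = \<one> then f * x else 0)"
      using finite_carrier by simp
    also have "\<dots> = (\<Sum>h\<in>carrier \<Gamma>. (\<Sum>Z\<in>Pow ?X. a Z * act h (b Z)) * act h x)"
      by (intro sum.cong) (auto simp: delta act_one)
    also have "\<dots> = (\<Sum>h\<in>carrier \<Gamma>. \<Sum>Z\<in>Pow ?X. act h (b Z * x) * a Z)"
      unfolding sum_distrib_right by (intro sum.cong refl) (simp add: act_simps mult_ac)
    \<comment> \<open>The inner sums are traces of \<open>b Z * x\<close>, hence invariant, and can
      be moved out of \<open>\<phi>\<close>.\<close>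
    also have "\<dots> = (\<Sum>Z\<in>Pow ?X. (\<Sum>h\<in>carrier \<Gamma>. act h (b Z * x)) * a Z)"
      by (subst sum.swap) (simp add: sum_distrib_right)
    finally have "\<phi> (f * x) = (\<Sum>Z\<in>Pow ?X. (\<Sum>h\<in>carrier \<Gamma>. act h (b Z * x)) * \<phi> (a Z))"
      by (simp add: linear_endo_sum[OF \<phi>] linear_endo_scale[OF \<phi> trace_in_inv_ring])
    also have "\<dots> = (\<Sum>Z\<in>Pow ?X. \<Sum>h\<in>carrier \<Gamma>. \<phi> (a Z) * act h (b Z) * act h x)"
      unfolding sum_distrib_right by (intro sum.cong refl) (simp add: act_simps mult_ac)
    also have "\<dots> = combination (\<lambda>h. \<Sum>Z\<in>Pow ?X. \<phi> (a Z) * act h (b Z)) x"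
      by (subst sum.swap) (simp add: combination_def sum_distrib_right)
    finally show ?thesis .
  qed
  then have "(\<lambda>x. \<phi> (f * x)) = combination (\<lambda>h. \<Sum>Z\<in>Pow ?X. \<phi> (a Z) * act h (b Z))"
    by blast
  then show ?thesis by (simp add: f_def)
qed

lemma carrier_End_ring_inv_ring: "carrier (End_ring inv_ring) = range combination"
proof -
  obtain s t where "regular_pair (act g (s g) - s g) (act g (t g) - t g)"
    if "g \<in> carrier \<Gamma> - {\<one>}" for g
    using unramified by (metis DiffE singletonI)
  then have "\<phi> \<in> range combination" if "linear_endo \<phi>" for \<phi>
    using combination_cancel_prod[of "carrier \<Gamma> - {\<one>}" s t \<phi>] linear_endo_comp_prod[OF that]
      finite_carrier that by blast
  then show ?thesis using linear_endo_combination by blast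
qed

section \<open>The isomorphism with the skew group ring\<close>

lemma skew_to_End_eq_combination:
  assumes "Poly_Mapping.keys u \<subseteq> carrier \<Gamma>"
  shows "skew_to_End act u = combination (Poly_Mapping.lookup u)"
  using assms finite_carrier
  by (auto simp: skew_to_End_def combination_def fun_eq_iff in_keys_iff intro!: sum.mono_neutral_left)

lemma skew_mult_eq:
  assumes "Poly_Mapping.keys u \<subseteq> carrier \<Gamma>" "Poly_Mapping.keys v \<subseteq> carrier \<Gamma>"
  shows "u \<otimes>\<^bsub>skew_group_ring \<Gamma> act\<^esub> v = (\<Sum>g\<in>carrier \<Gamma>. \<Sum>h\<in>carrier \<Gamma>.
    Poly_Mapping.single (g \<otimes> h) (Poly_Mapping.lookup u g * act g (Poly_Mapping.lookup v h)))"
  using assms finite_carrier by (intro skew_mult_superset) (auto intro: act_zero)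

theorem skew_to_End_iso:
  "skew_to_End act \<in> ring_iso (skew_group_ring \<Gamma> act) (End_ring inv_ring)"
proof -
  let ?S = "skew_group_ring \<Gamma> act"
  have carr: "carrier ?S = {u. Poly_Mapping.keys u \<subseteq> carrier \<Gamma>}"
    by (simp add: skew_group_ring_def)
  have add: "skew_to_End act (u + v) = (\<lambda>t. skew_to_End act u t + skew_to_End act v t)"
    if "u \<in> carrier ?S" "v \<in> carrier ?S" for u v
    using that Poly_Mapping.keys_add[of u v]
    by (subst (1 2 3) skew_to_End_eq_combination)
      (auto simp: carr combination_def lookup_add distrib_right sum.distrib)
  have sum_mem: "sum w A \<in> carrier ?S"
    if "\<And>x. x \<in> A \<Longrightarrow> w x \<in> carrier ?S" for w :: "'g \<Rightarrow> 'g \<Rightarrow>\<^sub>0 's" and A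
    using that
  proof (induction A rule: infinite_finite_induct)
    case (insert x A)
    then have "w x \<in> carrier ?S" "sum w A \<in> carrier ?S" by auto
    then show ?case
      using insert.hyps Poly_Mapping.keys_add[of "w x" "sum w A"] by (auto simp: carr)
  qed (auto simp: carr)
  have sum_hom: "skew_to_End act (sum w A) t = (\<Sum>x\<in>A. skew_to_End act (w x) t)"
    if "\<And>x. x \<in> A \<Longrightarrow> w x \<in> carrier ?S" for w :: "'g \<Rightarrow> 'g \<Rightarrow>\<^sub>0 's" and A t
    using that
  proof (induction A rule: infinite_finite_induct)
    case (insert x A)
    then have "w x \<in> carrier ?S" "sum w A \<in> carrier ?S" by (auto intro: sum_mem)
    then show ?case using insert by (simp add: add)
  qed (auto simp: skew_to_End_def)
  have single: "Poly_Mapping.single g s \<in> carrier ?S" if "g \<in> carrier \<Gamma>" for g s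
    using that by (auto simp: carr split: if_splits)
  have mult: "skew_to_End act (u \<otimes>\<^bsub>?S\<^esub> v) = skew_to_End act u \<circ> skew_to_End act v"
    if u: "u \<in> carrier ?S" and v: "v \<in> carrier ?S" for u v
  proof
    fix t
    let ?w = "\<lambda>g h. Poly_Mapping.single (g \<otimes> h) (Poly_Mapping.lookup u g * act g (Poly_Mapping.lookup v h))"
    \<comment> \<open>Additivity reduces the claim to single terms, where it is multiplicativity of
      \<open>act g\<close> together with \<open>act_mult\<close>.\<close>
    have "skew_to_End act (u \<otimes>\<^bsub>?S\<^esub> v) t = skew_to_End act (\<Sum>g\<in>carrier \<Gamma>. \<Sum>h\<in>carrier \<Gamma>. ?w g h) t"
      using u v by (simp only: skew_mult_eq carr mem_Collect_eq)
    also have "\<dots> = (\<Sum>g\<in>carrier \<Gamma>. skew_to_End act (\<Sum>h\<in>carrier \<Gamma>. ?w g h) t)"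
      by (intro sum_hom sum_mem single m_closed)
    also have "\<dots> = (\<Sum>g\<in>carrier \<Gamma>. \<Sum>h\<in>carrier \<Gamma>. skew_to_End act (?w g h) t)"
      by (intro sum.cong refl sum_hom single m_closed)
    also have "\<dots> = (\<Sum>g\<in>carrier \<Gamma>. \<Sum>h\<in>carrier \<Gamma>.
        Poly_Mapping.lookup u g * (act g (Poly_Mapping.lookup v h) * act g (act h t)))"
      by (intro sum.cong refl) (simp add: skew_to_End_single act_zero act_mult mult.assoc)
    also have "\<dots> = (skew_to_End act u \<circ> skew_to_End act v) t"
      using u v by (simp add: skew_to_End_eq_combination carr)
        (simp add: combination_def act_sum act_simps sum_distrib_left)
    finally show "skew_to_End act (u \<otimes>\<^bsub>?S\<^esub> v) t = (skew_to_End act u \<circ> skew_to_End act v) t" .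
  qed
  have inj: "inj_on (skew_to_End act) (carrier ?S)"
  proof (intro inj_onI poly_mapping_eqI)
    fix u v g assume uv: "u \<in> carrier ?S" "v \<in> carrier ?S" "skew_to_End act u = skew_to_End act v"
    then have "Poly_Mapping.lookup u g = Poly_Mapping.lookup v g" if "g \<in> carrier \<Gamma>"
      using combination_inject that by (simp add: skew_to_End_eq_combination carr)
    moreover have "Poly_Mapping.lookup u g = Poly_Mapping.lookup v g" if "g \<notin> carrier \<Gamma>"
      using uv that by (metis carr in_keys_iff mem_Collect_eq subsetD)
    ultimately show "Poly_Mapping.lookup u g = Poly_Mapping.lookup v g" by blast
  qed
  have surj: "skew_to_End act ` carrier ?S = carrier (End_ring inv_ring)"
  proof
    show "skew_to_End act ` carrier ?S \<subseteq> carrier (End_ring inv_ring)"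
      by (auto simp: skew_to_End_eq_combination carr linear_endo_combination)
    show "carrier (End_ring inv_ring) \<subseteq> skew_to_End act ` carrier ?S"
      unfolding carrier_End_ring_inv_ring
    proof clarify
      fix c :: "'g \<Rightarrow> 's"
      define u where "u = (\<Sum>g\<in>carrier \<Gamma>. Poly_Mapping.single g (c g))"
      have "u \<in> carrier ?S"
        unfolding u_def by (intro sum_mem single)
      moreover have "skew_to_End act u t = combination c t" for t
        unfolding u_def combination_def
        by (subst sum_hom) (auto simp: single skew_to_End_single act_zero)
      ultimately show "combination c \<in> skew_to_End act ` carrier ?S"
        by (metis ext image_eqI)
    qed
  qed
  have one: "skew_to_End act \<one>\<^bsub>?S\<^esub> = id"
    by (simp add: skew_group_ring_def skew_to_End_single act_zero act_one id_def)
  have "skew_to_End act \<in> ring_hom ?S (End_ring inv_ring)"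
  proof (rule ring_hom_memI)
    fix u v assume uv: "u \<in> carrier ?S" "v \<in> carrier ?S"
    show "skew_to_End act u \<in> carrier (End_ring inv_ring)" using surj uv by blast
    show "skew_to_End act (u \<otimes>\<^bsub>?S\<^esub> v) = skew_to_End act u \<otimes>\<^bsub>End_ring inv_ring\<^esub> skew_to_End act v"
      using mult[OF uv] by (simp add: End_ring_def)
    have "u \<oplus>\<^bsub>?S\<^esub> v = u + v" by (simp add: skew_group_ring_def)
    then show "skew_to_End act (u \<oplus>\<^bsub>?S\<^esub> v) = skew_to_End act u \<oplus>\<^bsub>End_ring inv_ring\<^esub> skew_to_End act v"
      using add[OF uv] by (simp add: End_ring_def)
  qed (simp add: one, simp add: End_ring_def)
  then show ?thesis
    using inj surj by (simp add: ring_iso_def bij_betw_def)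
qed

end

section \<open>Power series\<close>

text \<open>
  Minimising one coordinate after the other yields \<open>a \<in> A\<close> and \<open>b \<in> B\<close> whose sum is attained only
  once; this replaces the choice of a monomial order on the unordered index type.
\<close>

lemma unique_sum_coordinates:
  fixes A B :: "(nat ^ 'n::finite) set"
  assumes "finite I" "A \<noteq> {}" "B \<noteq> {}"
  shows "\<exists>a\<in>A. \<exists>b\<in>B. \<forall>x\<in>A. \<forall>y\<in>B. x + y = a + b \<longrightarrow> (\<forall>i\<in>I. x $ i = a $ i)"
  using assms
proof (induction I arbitrary: A B rule: finite_induct)
  case (insert k I)
  have least: "\<exists>c\<in>C. \<forall>x\<in>C. c $ k \<le> x $ k" if C: "C \<noteq> {}" for C :: "(nat ^ 'n) set"
  proof -
    obtain c where "c \<in> C" using C by blast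
    then have "\<exists>x. x \<in> C \<and> (\<forall>y. y \<in> C \<longrightarrow> x $ k \<le> y $ k)" by (rule ex_has_least_nat)
    then show ?thesis by blast
  qed
  obtain a0 where a0: "a0 \<in> A" "\<And>x. x \<in> A \<Longrightarrow> a0 $ k \<le> x $ k"
    using least[OF insert.prems(1)] by blast
  obtain b0 where b0: "b0 \<in> B" "\<And>y. y \<in> B \<Longrightarrow> b0 $ k \<le> y $ k"
    using least[OF insert.prems(2)] by blast
  define A' where "A' = {x \<in> A. x $ k = a0 $ k}"
  define B' where "B' = {y \<in> B. y $ k = b0 $ k}"
  have "a0 \<in> A'" "b0 \<in> B'"
    using a0(1) b0(1) by (simp_all add: A'_def B'_def)
  then have "A' \<noteq> {}" "B' \<noteq> {}" by blast+
  from insert.IH[OF this] obtain a b where ab: "a \<in> A'" "b \<in> B'"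
    and IH: "\<forall>x\<in>A'. \<forall>y\<in>B'. x + y = a + b \<longrightarrow> (\<forall>i\<in>I. x $ i = a $ i)"
    by (elim bexE)
  have unique: "\<forall>i\<in>insert k I. x $ i = a $ i" if xy: "x \<in> A" "y \<in> B" "x + y = a + b" for x y
  proof -
    have "x $ k + y $ k = a0 $ k + b0 $ k"
      using arg_cong[OF xy(3), of "\<lambda>v. v $ k"] ab by (simp add: A'_def B'_def)
    then have k: "x $ k = a0 $ k" "y $ k = b0 $ k"
      using a0(2)[OF xy(1)] b0(2)[OF xy(2)] by linarith+
    then have "x \<in> A'" "y \<in> B'" using xy by (simp_all add: A'_def B'_def)
    then have "\<forall>i\<in>I. x $ i = a $ i" using IH xy(3) by blast
    moreover have "x $ k = a $ k" using k ab by (simp add: A'_def)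
    ultimately show ?thesis by blast
  qed
  show ?case
  proof (intro bexI ballI impI)
    show "a \<in> A" "b \<in> B" using ab by (simp_all add: A'_def B'_def)
    show "x $ i = a $ i" if "x \<in> A" "y \<in> B" "x + y = a + b" "i \<in> insert k I" for x y i
      using unique[OF that(1-3)] that(4) by blast
  qed
qed auto

text \<open>For the exponents \<open>a\<close> and \<open>b\<close> of
  \<open>unique_sum_coordinates\<close>, applied to the supports, the coefficient of
  \<open>f * g\<close> at \<open>a + b\<close> is a single nonzero product.\<close>

instance mfps :: (idom, finite) idom
proof
  fix f g :: "('a, 'b) mfps"
  assume "f \<noteq> 0" "g \<noteq> 0"
  then have "{x. mfps_nth f x \<noteq> 0} \<noteq> {}" "{y. mfps_nth g y \<noteq> 0} \<noteq> {}"
    using mfps_eqI[of f 0] mfps_eqI[of g 0] by auto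
  then obtain a b where a: "mfps_nth f a \<noteq> 0" and b: "mfps_nth g b \<noteq> 0"
    and unique: "\<And>x y. mfps_nth f x \<noteq> 0 \<Longrightarrow> mfps_nth g y \<noteq> 0 \<Longrightarrow> x + y = a + b \<Longrightarrow> x = a"
    using unique_sum_coordinates[of UNIV "{x. mfps_nth f x \<noteq> 0}" "{y. mfps_nth g y \<noteq> 0}"]
    unfolding vec_eq_iff[of _ "_ :: nat ^ 'b"] by (simp only: mem_Collect_eq finite UNIV_I) blast
  have "mfps_nth (f * g) (a + b) = (\<Sum>x\<in>exponent_splits (a + b). if x = (a, b) then mfps_nth f a * mfps_nth g b else 0)"
    unfolding mfps_nth_mult
  proof (intro sum.cong refl)
    fix x assume "x \<in> exponent_splits (a + b)"
    then have "fst x + snd x = a + b" by (auto simp: exponent_splits_def)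
    then show "mfps_nth f (fst x) * mfps_nth g (snd x) = (if x = (a, b) then mfps_nth f a * mfps_nth g b else 0)"
    proof (cases "mfps_nth f (fst x) = 0 \<or> mfps_nth g (snd x) = 0")
      case True
      then have "x \<noteq> (a, b)" using a b by auto
      then show ?thesis using True by auto
    next
      case False
      then have "fst x = a" using unique \<open>fst x + snd x = a + b\<close> by blast
      then have "x = (a, b)" using \<open>fst x + snd x = a + b\<close> by (simp add: prod_eq_iff)
      then show ?thesis by simp
    qed
  qed
  also have "\<dots> = mfps_nth f a * mfps_nth g b"
    by (subst sum.delta) (simp_all, auto simp: exponent_splits_def)
  also have "\<dots> \<noteq> 0" using a b by simp
  finally show "f * g \<noteq> 0" by auto
qed

section \<open>Divisibility by the variables\<close>

lemma mfps_nth_var_mult: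
  "mfps_nth (mfps_var i * f) m = (if m $ i = 0 then 0 else mfps_nth f (m - axis i 1))"
proof -
  have "mfps_nth (mfps_var i * f) m =
      (\<Sum>x\<in>exponent_splits m. if x = (axis i 1, m - axis i 1) then (if m $ i = 0 then 0 else mfps_nth f (m - axis i 1)) else 0)"
    unfolding mfps_nth_mult
  proof (intro sum.cong refl)
    fix x assume "x \<in> exponent_splits m"
    then have x: "m = fst x + snd x" by (auto simp: exponent_splits_def)
    have "snd x = m - axis i 1" "m $ i \<noteq> 0" if "fst x = axis i 1"
      using that x by (auto simp: vec_eq_iff axis_def)
    then show "mfps_nth (mfps_var i) (fst x) * mfps_nth f (snd x) =
      (if x = (axis i 1, m - axis i 1) then (if m $ i = 0 then 0 else mfps_nth f (m - axis i 1)) else 0)"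
      by (cases x) (auto simp: mfps_var.rep_eq)
  qed
  also have "\<dots> = (if m $ i = 0 then 0 else mfps_nth f (m - axis i 1))"
    by (subst sum.delta) (simp_all, auto simp: exponent_splits_def vec_eq_iff axis_def)
  finally show ?thesis .
qed

lemma mfps_var_dvd:
  fixes f :: "('a::comm_ring_1, 'n::finite) mfps"
  assumes "\<And>m. m $ i = 0 \<Longrightarrow> mfps_nth f m = 0"
  shows "mfps_var i dvd f"
proof
  show "f = mfps_var i * Abs_mfps (\<lambda>m. mfps_nth f (m + axis i 1))"
  proof (rule mfps_eqI)
    fix m :: "nat ^ 'n"
    have "m - axis i 1 + axis i 1 = m" if "m $ i \<noteq> 0"
      using that by (auto simp: vec_eq_iff axis_def)
    then show "mfps_nth f m = mfps_nth (mfps_var i * Abs_mfps (\<lambda>m. mfps_nth f (m + axis i 1))) m"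
      using assms by (simp add: mfps_nth_var_mult Abs_mfps_inverse)
  qed
qed

text \<open>Compare coefficients at \<open>m + axis j 1\<close> where \<open>m $ i = 0\<close>: on
  the side divisible by the variable \<open>i\<close> this coefficient is zero, on the other it is
  that of \<open>v\<close> at \<open>m\<close>.\<close>

lemma regular_pair_vars:
  assumes "i \<noteq> j"
  shows "regular_pair (mfps_var i :: ('a::comm_ring_1, 'n::finite) mfps) (mfps_var j)"
  unfolding regular_pair_def
proof (intro conjI allI impI)
  have "mfps_nth (mfps_var i :: ('a, 'n) mfps) (axis i 1) = 1" by (simp add: mfps_var.rep_eq)
  then show "mfps_var i \<noteq> (0 :: ('a, 'n) mfps)" by (metis mfps_nth_ring(1) zero_neq_one)
  fix u v :: "('a, 'n) mfps" assume eq: "mfps_var i * u = mfps_var j * v"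
  show "mfps_var i dvd v"
  proof (rule mfps_var_dvd)
    fix m :: "nat ^ 'n" assume "m $ i = 0"
    then have "mfps_nth (mfps_var i * u) (m + axis j 1) = 0"
      using assms by (simp add: mfps_nth_var_mult axis_def)
    then show "mfps_nth v m = 0"
      unfolding eq by (simp add: mfps_nth_var_mult axis_def)
  qed
qed

text \<open>Elimination: from a pivot at row \<open>k\<close> of column \<open>i\<close>, clear row
  \<open>k\<close> of another column \<open>j\<close>. The remainder is nonzero for some
  \<open>j\<close>, since otherwise all rows are multiples of one vector. The two resulting columns
  are completed to an invertible matrix so that they become images of coordinate vectors.\<close>

lemma independent_columns:
  fixes M :: "'l::field ^ 'd::finite ^ 'd"
  assumes "\<not> rank M \<le> 1"
  obtains i j q k m and B :: "'l ^ 'd ^ 'd"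
    where "invertible B" "k \<noteq> m" "column k B = column i M" "column m B = column j M - q *s column i M"
proof -
  have "M \<noteq> 0"
  proof
    assume "M = 0"
    then have "rows M \<subseteq> vec.span {}" by (auto simp: rows_def row_def vec_eq_iff)
    then have "vec.dim (rows M) \<le> card ({} :: ('l ^ 'd) set)" by (rule vec.dim_le_card) simp
    then show False using assms unfolding row_rank_def_gen card.empty by linarith
  qed
  then obtain k i where ki: "M $ k $ i \<noteq> 0" by (auto simp: vec_eq_iff)
  define q where "q j = M $ k $ j / M $ k $ i" for j
  have "\<exists>j. column j M \<noteq> q j *s column i M"
  proof (rule ccontr)
    assume "\<not> ?thesis"
    then have col: "column j M = q j *s column i M" for j by blast
    have entry: "M $ r $ j = M $ r $ i * q j" for r j
      using arg_cong[OF col[of j], of "\<lambda>v. v $ r"] by (simp add: column_def mult.commute)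
    have "row r M = M $ r $ i *s (\<chi> j. q j)" for r
      by (simp add: vec_eq_iff row_def) (blast intro: entry)
    moreover have "M $ r $ i *s (\<chi> j. q j) \<in> vec.span {\<chi> j. q j}" for r
      by (rule vec.span_scale, rule vec.span_base) simp
    ultimately have "rows M \<subseteq> vec.span {\<chi> j. q j}" by (auto simp: rows_def)
    then have "vec.dim (rows M) \<le> card {\<chi> j. q j}" by (rule vec.dim_le_card) simp
    then show False using assms by (simp add: row_rank_def_gen)
  qed
  then obtain j where j: "column j M \<noteq> q j *s column i M" by blast
  define c where "c = column i M"
  define e where "e = column j M - q j *s column i M"
  have "e \<noteq> 0" using j by (simp add: e_def)
  then obtain m where m: "e $ m \<noteq> 0" by (auto simp: vec_eq_iff)
  have ck: "c $ k \<noteq> 0" and ek: "e $ k = 0"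
    using ki by (simp_all add: c_def e_def column_def q_def)
  have km: "k \<noteq> m" using m ek by auto
  \<comment> \<open>The identity matrix with columns \<open>k\<close> and \<open>m\<close> replaced
    by \<open>c\<close> and \<open>e\<close>.\<close>
  define B :: "'l ^ 'd ^ 'd" where
    "B = (\<chi> r s. if s = k then c $ r else if s = m then e $ r else if r = s then 1 else 0)"
  have "x = 0" if x: "B *v x = 0" for x
  proof -
    have comp: "c $ r * x $ k + e $ r * x $ m + (if r \<in> {k, m} then 0 else x $ r) = 0" for r
    proof -
      have "0 = (\<Sum>s\<in>UNIV. B $ r $ s * x $ s)"
        using arg_cong[OF x, of "\<lambda>v. v $ r"] by (simp add: matrix_vector_mult_def)
      also have "\<dots> = (\<Sum>s\<in>UNIV. (if s = k then c $ r * x $ k else 0) + (if s = m then e $ r * x $ m else 0) +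
          (if s = r then (if r \<in> {k, m} then 0 else x $ r) else 0))"
        using km by (intro sum.cong) (auto simp: B_def)
      also have "\<dots> = c $ r * x $ k + e $ r * x $ m + (if r \<in> {k, m} then 0 else x $ r)"
        by (simp add: sum.distrib)
      finally show ?thesis by simp
    qed
    \<comment> \<open>Row \<open>k\<close> comes first: there \<open>e\<close> vanishes and
      \<open>c\<close> does not. Row \<open>m\<close> then yields \<open>x $ m\<close>, and the
      other rows reduce to their diagonal entries.\<close>
    have xk: "x $ k = 0" using comp[of k] ck ek by simp
    moreover have "x $ m = 0" using comp[of m] m xk by simp
    ultimately have "x $ r = 0" for r
      using comp[of r] by (cases "r \<in> {k, m}") auto
    then show "x = 0" by (simp add: vec_eq_iff)
  qed
  then have "invertible B"
    using matrix_left_invertible_ker[of B] by (auto simp: invertible_left_inverse)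
  moreover have "column k B = column i M" "column m B = column j M - q j *s column i M"
    using km by (simp_all add: column_def B_def vec_eq_iff c_def e_def)
  ultimately show ?thesis using that km by metis
qed

section \<open>Regular pairs from group elements\<close>

lemma mfps_const_diff: "mfps_const (a - b) = mfps_const a - mfps_const b"
  by (rule mfps_eqI) (simp add: mfps_const.rep_eq)

lemma linear_form_cong: "column i A = column j B \<Longrightarrow> linear_form A i = linear_form B j"
  by (simp add: linear_form_def column_def vec_eq_iff)

lemma mfps_act_ring_iso:
  assumes "(A, \<sigma>) \<in> carrier (GL_Gal K)"
  shows "mfps_act (A, \<sigma>) \<in> ring_iso ring_of_type_algebra ring_of_type_algebra"
  using mfps_act_unique[OF assms] by blast

text \<open>On variables, \<open>A\<close> minus the identity yields the linear forms given by the
  columns of \<open>A - mat 1\<close>. By \<open>independent_columns\<close>, two combinations of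
  them are the images of distinct variables under the automorphism given by
  \<open>B\<close>.\<close>

lemma regular_pair_linear:
  fixes A :: "'l::field ^ 'd::finite ^ 'd"
  assumes "\<not> rank (A - mat 1) \<le> 1"
  shows "\<exists>s t. regular_pair (mfps_act (A, id) s - s) (mfps_act (A, id) t - t)"
proof -
  obtain i j q k m and B :: "'l ^ 'd ^ 'd" where B: "invertible B" "k \<noteq> m"
    "column k B = column i (A - mat 1)" "column m B = column j (A - mat 1) - q *s column i (A - mat 1)"
    using independent_columns[OF assms] .
  have id: "id \<in> ring_iso field_ring field_ring" by (simp add: field_ring_iso_iff)
  have var: "mfps_act (A, id) (mfps_var j) - mfps_var j = linear_form (A - mat 1) j" for j
  proof -
    have "mfps_act (A, id) (mfps_var j) - mfps_var j = linear_form A j - linear_form (mat 1) j"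
      using mfps_act_var[OF id, of "mat 1" j] by (simp add: mfps_act_var[OF id] mfps_act_one)
    then show ?thesis
      by (simp add: linear_form_def mfps_const_diff sum_subtractf left_diff_distrib)
  qed
  define s :: "('l, 'd) mfps" where "s = mfps_var i"
  define t :: "('l, 'd) mfps" where "t = mfps_var j - mfps_const q * mfps_var i"
  have s: "mfps_act (A, id) s - s = mfps_act (B, id) (mfps_var k)"
    unfolding s_def var mfps_act_var[OF id, of B] using B(3) by (intro linear_form_cong) simp
  have "mfps_act (A, id) t - t = linear_form (A - mat 1) j - mfps_const q * linear_form (A - mat 1) i"
    unfolding t_def var[symmetric]
    by (simp add: mfps_act_diff[OF id] mfps_act_mult[OF id] mfps_act_const[OF id] algebra_simps)
  also have "\<dots> = linear_form B m"
  proof -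
    have "B $ r $ m = (A - mat 1) $ r $ j - q * (A - mat 1) $ r $ i" for r
      using B(4) by (simp add: column_def vec_eq_iff)
    then show ?thesis
      by (simp add: linear_form_def mfps_const_diff mfps_const_simps sum_subtractf left_diff_distrib
          sum_distrib_left mult.assoc del: vector_minus_component)
  qed
  finally have t: "mfps_act (A, id) t - t = mfps_act (B, id) (mfps_var m)"
    by (simp add: mfps_act_var[OF id])
  \<comment> \<open>Any base field would do here; membership gives bijectivity of the
    substitution.\<close>
  have "(B, id) \<in> carrier (GL_Gal (UNIV :: 'l set))"
    using B(1) id by (auto simp: GL_Gal_def Gal_def)
  then have bij: "bij (mfps_act (B, id))"
    using mfps_act_ring_iso by (auto simp: ring_iso_def ring_of_type_algebra_def)
  have zero: "mfps_act (B, id) 0 = 0"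
    using mfps_act_const[OF id, of B 0] by (simp add: mfps_const_simps)
  have "regular_pair (mfps_act (B, id) (mfps_var k)) (mfps_act (B, id) (mfps_var m))"
    using bij mfps_act_mult[OF id] zero regular_pair_vars[OF B(2)] by (rule regular_pair_image)
  then show ?thesis unfolding s[symmetric] t[symmetric] by blast
qed

text \<open>A constant \<open>c\<close> moved by \<open>\<sigma>\<close> makes the first entry a
  nonzero constant, hence a unit; the second entry is arbitrary.\<close>

lemma regular_pair_galois:
  assumes \<sigma>: "\<sigma> \<in> ring_iso field_ring field_ring" and "\<sigma> \<noteq> id"
  shows "\<exists>s t. regular_pair (mfps_act (A, \<sigma>) s - s) (mfps_act (A, \<sigma>) t - t)"
proof -
  obtain c where c: "\<sigma> c - c \<noteq> 0" using \<open>\<sigma> \<noteq> id\<close> by (auto simp: fun_eq_iff)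
  let ?s = "mfps_const c"
  have "mfps_act (A, \<sigma>) ?s - ?s = mfps_const (\<sigma> c - c)"
    by (simp add: mfps_act_const[OF \<sigma>] mfps_const_diff)
  moreover have "mfps_const (\<sigma> c - c) * mfps_const (inverse (\<sigma> c - c)) = 1"
    using c by (simp add: mfps_const_simps(2,4)[symmetric] del: mfps_const_simps)
  ultimately have "mfps_act (A, \<sigma>) ?s - ?s dvd 1" by (metis dvd_triv_left)
  then show ?thesis using regular_pair_unit by blast
qed

theorem theorem0p10:
  fixes K :: "'l::field set" and G :: "('l, 'd::finite) semilinear set"
  assumes "CARD('d) \<ge> 2"
    and "finite_galois K"
    and "subgroup G (GL_Gal K)" and "finite G"
    and "\<not> CHAR('l) dvd card G"
    and "K = fixed_field G"
    and "small (linear_part G)"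
  shows "skew_to_End mfps_act \<in>
           ring_iso (skew_group_ring (GL_Gal K\<lparr>carrier := G\<rparr>) mfps_act) (End_ring (invariants G))
       \<and> skew_group_ring (GL_Gal K\<lparr>carrier := G\<rparr>) mfps_act \<simeq> End_ring (invariants G)"
proof -
  interpret \<Gamma>: group "GL_Gal K :: ('l, 'd) semilinear monoid" by (rule group_GL_Gal)
  have sub: "g \<in> carrier (GL_Gal K)" if "g \<in> G" for g
    using subgroup.subset[OF assms(3)] that by blast
  interpret unramified_action "GL_Gal K\<lparr>carrier := G\<rparr>" mfps_act
  proof (rule unramified_action.intro[OF \<Gamma>.subgroup_imp_group[OF assms(3)]], unfold_locales)
    fix g assume g: "g \<in> carrier (GL_Gal K\<lparr>carrier := G\<rparr>)"
    obtain A \<sigma> where A: "g = (A, \<sigma>)" by (cases g)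
    have AG: "(A, \<sigma>) \<in> G" and "invertible A" and \<sigma>: "\<sigma> \<in> ring_iso field_ring field_ring"
      using g sub[of g] by (auto simp: GL_Gal_def A intro: Gal_iso)
    show "mfps_act g \<in> ring_hom ring_of_type_algebra ring_of_type_algebra"
      unfolding A by (rule mfps_act_hom[OF \<sigma>])
    show "mfps_act (g \<otimes>\<^bsub>GL_Gal K\<lparr>carrier := G\<rparr>\<^esub> h) = mfps_act g \<circ> mfps_act h"
      if "h \<in> carrier (GL_Gal K\<lparr>carrier := G\<rparr>)" for h
      using g that sub by (simp add: mfps_act_GL_Gal_mult)
    assume "g \<noteq> \<one>\<^bsub>GL_Gal K\<lparr>carrier := G\<rparr>\<^esub>"
    then have ne: "A \<noteq> mat 1 \<or> \<sigma> \<noteq> id" by (auto simp: A GL_Gal_def)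
    show "\<exists>s t. regular_pair (mfps_act g s - s) (mfps_act g t - t)"
    proof (cases "\<sigma> = id")
      case True
      \<comment> \<open>Now \<open>A\<close> is a nontrivial element of the linear part, so
        smallness applies.\<close>
      then have "\<not> rank (A - mat 1) \<le> 1"
        using AG ne \<open>small (linear_part G)\<close> \<open>invertible A\<close>
        by (auto simp: small_def linear_part_def pseudo_reflection_def)
      then show ?thesis unfolding A True by (rule regular_pair_linear)
    next
      case False
      then show ?thesis unfolding A by (rule regular_pair_galois[OF \<sigma>])
    qed
  qed (use \<open>finite G\<close> in \<open>simp_all add: mfps_act_GL_Gal_one\<close>)
  have "inv_ring = invariants G"
    by (simp add: inv_ring_def invariants_def)
  then have "skew_to_End mfps_act \<in>
      ring_iso (skew_group_ring (GL_Gal K\<lparr>carrier := G\<rparr>) mfps_act) (End_ring (invariants G))"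
    using skew_to_End_iso by simp
  then show ?thesis by (auto simp: is_ring_iso_def)
qed

end
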